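(* Let $t\ge 2$, fix integers $a_1<a_2<\cdots<a_t$, and consider the random fewnomial $f=c_1x^{a_1}+c_2x^{a_2}+\cdots+c_tx^{a_t}$ with i.i.d. uniformly distributed coefficients $c_j\in R$. Then the expected number of zeros of $f$ in $R\setminus\{0\}$ is at most $(1+\varepsilon)^{-1}$, with equality if and only if $a_2-a_1=1$. Moreover, the expected number of zeros of $f$ in $K^\times$ is at most one, with equality if and only if $a_2-a_1=a_t-a_{t-1}=1$.
   Context: $K$ is a nonarchimedean local field of characteristic zero with valuation ring $R$; $q$ is the cardinality of the residue field and $\varepsilon=q^{-1}$. "Uniformly distributed in $R$" refers to the normalized Haar measure on the additive group $R$. *)

theory Defs
  imports "HOL-Probability.Probability"
begin

text \<open>The absolute value induces the metric, from which \<open>absval x \<ge> 0\<close> and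
  \<open>absval x = 0 \<longleftrightarrow> x = 0\<close> follow.\<close>

class nonarch_valued_field = field + metric_space +
  fixes absval :: "'a \<Rightarrow> real"
  assumes dist_absval: "dist x y = absval (x - y)"
    and absval_mult: "absval (x * y) = absval x * absval y"
    and absval_ultrametric: "absval (x + y) \<le> max (absval x) (absval y)"
begin

definition valuation_ring :: "'a set" where
  "valuation_ring = {x. absval x \<le> 1}"

definition maximal_ideal :: "'a set" where
  "maximal_ideal = {x. absval x < 1}"

text \<open>The underlying set of the residue field: the cosets of the maximal ideal in the
  valuation ring.\<close>

definition residue_field :: "'a set set" where
  "residue_field =
     valuation_ring // {(x, y). x \<in> valuation_ring \<and> y \<in> valuation_ring \<and> x - y \<in> maximal_ideal}"

end

text \<open>Local field: complete for a nontrivial discrete absolute value with finite residue field.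
  The normalisation of the absolute value is left free: the valuation ring, the topology and
  the Borel sets do not depend on it.\<close>

class nonarch_local_field_char_0 = nonarch_valued_field + field_char_0 + complete_space +
  assumes absval_discrete:
      "\<exists>\<pi>. 0 < absval \<pi> \<and> absval \<pi> < 1 \<and> (\<forall>x. x \<noteq> 0 \<longrightarrow> (\<exists>n::int. absval x = absval \<pi> powi n))"
    and finite_residue_field: "finite residue_field"

text \<open>The translation-invariant Borel probability measure on the compact additive group
  \<open>valuation_ring\<close>. Regularity needs no separate clause, since finite Borel measures on compact
  metric spaces are regular.\<close>

definition normalized_haar_measure :: "'k::nonarch_local_field_char_0 measure \<Rightarrow> bool" where
  "normalized_haar_measure \<mu> \<longleftrightarrow>
     sets \<mu> = sets (restrict_space borel valuation_ring) \<and>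
     emeasure \<mu> (space \<mu>) = 1 \<and>
     (\<forall>a\<in>valuation_ring. \<forall>A\<in>sets \<mu>. emeasure \<mu> ((\<lambda>x. a + x) ` A) = emeasure \<mu> A)"

definition uniform_in_valuation_ring ::
    "'w measure \<Rightarrow> ('w \<Rightarrow> 'k::nonarch_local_field_char_0) \<Rightarrow> bool" where
  "uniform_in_valuation_ring M X \<longleftrightarrow>
     X \<in> measurable M (restrict_space borel valuation_ring) \<and>
     normalized_haar_measure (distr M (restrict_space borel valuation_ring) X)"

text \<open>The exponents may be negative, so a fewnomial is only meaningful at \<open>x \<noteq> 0\<close>.\<close>

definition fewnomial :: "nat \<Rightarrow> (nat \<Rightarrow> int) \<Rightarrow> (nat \<Rightarrow> 'k::field) \<Rightarrow> 'k \<Rightarrow> 'k" where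
  "fewnomial t a c x = (\<Sum>j=1..t. c j * x powi a j)"

text \<open>Zeros are counted as points, without multiplicity; the count is \<open>\<infinity>\<close> if there are
  infinitely many of them.\<close>

definition num_zeros :: "('k::zero \<Rightarrow> 'k) \<Rightarrow> 'k set \<Rightarrow> ennreal" where
  "num_zeros f S = emeasure (count_space UNIV) {x \<in> S. f x = 0}"

definition expected_zeros ::
    "'w measure \<Rightarrow> nat \<Rightarrow> (nat \<Rightarrow> int) \<Rightarrow> (nat \<Rightarrow> 'w \<Rightarrow> 'k::field) \<Rightarrow> 'k set \<Rightarrow> ennreal" where
  "expected_zeros M t a c S = (\<integral>\<^sup>+ \<omega>. num_zeros (fewnomial t a (\<lambda>j. c j \<omega>)) S \<partial>M)"

end

theory Submission
  imports Defs
begin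

text \<open>
  Write \<open>\<bar>\<cdot>\<bar>\<close> for the absolute value normalized so that a uniformizer has value \<open>\<epsilon>\<close>.  On the
  valuation ring, dividing \<open>f\<close> by \<open>x^(a 1)\<close> gives \<open>c 1 + g(x)\<close>, where \<open>g\<close> is a polynomial without
  constant term whose coefficients are independent of the uniform variable \<open>c 1\<close>.  Near a point
  \<open>x\<close> with \<open>g'(x) \<noteq> 0\<close> the map \<open>g\<close> scales Haar measure by \<open>\<bar>g'(x)\<bar>\<close>, so the zeros have density
  \<open>E \<bar>g'(x)\<bar>\<close> at \<open>x\<close>.  Now \<open>g'(x)\<close> is a linear form in the remaining coefficients.  By the
  ultrametric inequality and translation invariance it is distributed like \<open>D U\<close>, where \<open>U\<close> is
  uniform and \<open>D\<close> is its largest coefficient (\<open>prob_form\<close>), and \<open>E \<bar>U\<bar> = 1 / (1 + \<epsilon>)\<close>.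
  With \<open>b j = a j - a 1\<close>, \<open>\<bar>D\<bar>\<close> is the maximum of \<open>\<bar>b j x^(b j - 1)\<bar>\<close> over \<open>j \<ge> 2\<close>.  It is at most 1, equal
  to 1 everywhere if some \<open>b j\<close> is 1, and at most \<open>\<epsilon>\<close> on the maximal ideal otherwise.  Since the
  exponents increase, \<open>b j = 1\<close> can only occur for \<open>j = 2\<close>.

  The zeros with \<open>\<bar>x\<bar> > 1\<close> become zeros \<open>y = 1 / x\<close> in the maximal ideal, of measure \<open>\<epsilon>\<close>,
  with the order of the exponents reversed.  The same argument bounds their expected number by
  \<open>\<epsilon> / (1 + \<epsilon>)\<close>, with equality iff the last two exponents are consecutive, and
  \<open>1 / (1 + \<epsilon>) + \<epsilon> / (1 + \<epsilon>) = 1\<close>.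

  The change of variables is carried out by finite counting.  For each \<open>n\<close> the valuation ring has
  finitely many residue classes modulo the \<open>n\<close>-th power of the maximal ideal, and Hensel's lemma
  (\<open>hensel\<close>) tells which classes contain a zero where the derivative lies outside that power.  The
  number of these classes increases to the number of simple zeros
  (\<open>num_simple_zeros_eq_SUP\<close>); its mean is a finite sum of probabilities that
  independence determines (\<open>prob_near_zero_event\<close>); and double zeros almost surely do not occur
  (\<open>AE_simple_zeros\<close>).  Monotone convergence gives the expected number of zeros in a ball
  (\<open>expected_zeros_in_ball\<close>), from which the theorem follows by the two substitutions.
\<close>

section \<open>Absolute value and powers of the maximal ideal\<close>

lemma absval_nonneg [simp]: "0 \<le> absval (x::'k::nonarch_valued_field)"
  using dist_absval[of x 0] zero_le_dist[of x 0] by simp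

lemma absval_eq_0_iff [simp]: "absval (x::'k::nonarch_valued_field) = 0 \<longleftrightarrow> x = 0"
  using dist_absval[of x 0] dist_eq_0_iff[of x 0] by simp

lemma absval_0 [simp]: "absval (0::'k::nonarch_valued_field) = 0"
  by simp

lemma absval_pos_iff [simp]: "0 < absval (x::'k::nonarch_valued_field) \<longleftrightarrow> x \<noteq> 0"
  using absval_nonneg[of x] absval_eq_0_iff[of x] by linarith

lemma absval_1 [simp]: "absval (1::'k::nonarch_valued_field) = 1"
  using absval_mult[of "1::'k" 1] absval_eq_0_iff[of "1::'k"] by simp

lemma absval_minus [simp]: "absval (- x) = absval (x::'k::nonarch_valued_field)"
  using dist_commute[of x 0] by (simp add: dist_absval)

lemma absval_diff_le: "absval (x - y) \<le> max (absval x) (absval (y::'k::nonarch_valued_field))"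
  using absval_ultrametric[of x "- y"] by simp

lemma absval_minus_commute: "absval (x - y) = absval (y - (x::'k::nonarch_valued_field))"
  using absval_minus[of "x - y"] by simp

lemma absval_power: "absval (x ^ n) = absval (x::'k::nonarch_valued_field) ^ n"
  by (induction n) (auto simp: absval_mult)

lemma absval_divide: "absval (x / y) = absval x / absval (y::'k::nonarch_valued_field)"
proof (cases "y = 0")
  case False
  then have "absval (x / y) * absval y = absval x"
    by (simp flip: absval_mult)
  then show ?thesis using False by (simp add: field_simps)
qed auto

definition uniformizer :: "'k::nonarch_local_field_char_0" where
  "uniformizer = (SOME \<pi> :: 'k. 0 < absval \<pi> \<and> absval \<pi> < 1 \<and>
     (\<forall>x :: 'k. x \<noteq> 0 \<longrightarrow> (\<exists>n::int. absval x = absval \<pi> powi n)))"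

lemma uniformizer:
  "0 < absval (uniformizer :: 'k::nonarch_local_field_char_0)"
  "absval (uniformizer :: 'k) < 1"
  "(x::'k) \<noteq> 0 \<Longrightarrow> \<exists>n::int. absval x = absval (uniformizer::'k) powi n"
  using someI_ex[OF absval_discrete] unfolding uniformizer_def[symmetric] by auto

lemma uniformizer_nonzero [simp]: "(uniformizer :: 'k::nonarch_local_field_char_0) \<noteq> 0"
  using uniformizer(1) by force

text \<open>The powers of the maximal ideal are the balls around \<open>0\<close>, indexed here independently of the
  normalisation of the absolute value.  In the comments, an element is of level \<open>n\<close> if it lies in
  the \<open>n\<close>-th power, and its level is the largest such \<open>n\<close>.\<close>

definition ideal_power :: "nat \<Rightarrow> 'k::nonarch_local_field_char_0 set" where
  "ideal_power n = {x. absval x \<le> absval (uniformizer::'k) ^ n}"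

lemma ideal_power_0: "ideal_power 0 = (valuation_ring :: 'k::nonarch_local_field_char_0 set)"
  by (auto simp: ideal_power_def valuation_ring_def)

lemma zero_in_ideal_power [simp]: "(0::'k::nonarch_local_field_char_0) \<in> ideal_power n"
  using uniformizer(1)[where 'k='k] by (auto simp: ideal_power_def)

lemma one_in_ideal_power_0 [simp]: "(1::'k::nonarch_local_field_char_0) \<in> ideal_power 0"
  by (auto simp: ideal_power_def)

lemma ideal_power_antimono:
  assumes "m \<le> n" shows "ideal_power n \<subseteq> (ideal_power m :: 'k::nonarch_local_field_char_0 set)"
proof -
  have "absval (uniformizer::'k) ^ n \<le> absval (uniformizer::'k) ^ m"
    using assms uniformizer[where 'k='k] by (intro power_decreasing) auto
  then show ?thesis by (auto simp: ideal_power_def)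
qed

lemma ideal_power_add:
  "x \<in> ideal_power n \<Longrightarrow> y \<in> ideal_power n \<Longrightarrow> x + (y::'k::nonarch_local_field_char_0) \<in> ideal_power n"
  using absval_ultrametric[of x y] by (auto simp: ideal_power_def)

lemma ideal_power_minus [simp]:
  "- x \<in> ideal_power n \<longleftrightarrow> (x::'k::nonarch_local_field_char_0) \<in> ideal_power n"
  by (auto simp: ideal_power_def)

lemma ideal_power_diff:
  "x \<in> ideal_power n \<Longrightarrow> y \<in> ideal_power n \<Longrightarrow> x - (y::'k::nonarch_local_field_char_0) \<in> ideal_power n"
  using absval_diff_le[of x y] by (auto simp: ideal_power_def)

lemma ideal_power_diff_commute:
  "x - y \<in> ideal_power n \<longleftrightarrow> y - (x::'k::nonarch_local_field_char_0) \<in> ideal_power n"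
  by (simp add: ideal_power_def absval_minus_commute)

lemma ideal_power_mult:
  "x \<in> ideal_power m \<Longrightarrow> y \<in> ideal_power n \<Longrightarrow> x * (y::'k::nonarch_local_field_char_0) \<in> ideal_power (m + n)"
  by (auto simp: ideal_power_def absval_mult power_add intro!: mult_mono)

lemma ideal_power_0_mult:
  "x \<in> ideal_power 0 \<Longrightarrow> y \<in> ideal_power n \<Longrightarrow> x * (y::'k::nonarch_local_field_char_0) \<in> ideal_power n"
  using ideal_power_mult[of x 0 y n] by simp

lemma ideal_power_0_power:
  "(x::'k::nonarch_local_field_char_0) \<in> ideal_power 0 \<Longrightarrow> x ^ n \<in> ideal_power 0"
  by (auto simp: ideal_power_def absval_power power_le_one)

lemma ideal_power_0_of_nat [simp]: "(of_nat n :: 'k::nonarch_local_field_char_0) \<in> ideal_power 0"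
  by (induction n) (auto intro!: ideal_power_add)

lemma ideal_power_sum:
  "(\<And>i. i \<in> I \<Longrightarrow> f i \<in> ideal_power n) \<Longrightarrow> (\<Sum>i\<in>I. f i :: 'k::nonarch_local_field_char_0) \<in> ideal_power n"
  by (induction I rule: infinite_finite_induct) (auto intro!: ideal_power_add)

text \<open>Discreteness of the value group: no absolute value lies strictly between two consecutive powers
  of that of the uniformizer.\<close>

lemma absval_level:
  assumes "(x::'k::nonarch_local_field_char_0) \<in> ideal_power k" "x \<notin> ideal_power (Suc k)"
  shows "absval x = absval (uniformizer::'k) ^ k"
proof -
  let ?p = "absval (uniformizer::'k)"
  have p: "0 < ?p" "?p < 1" using uniformizer[where 'k='k] by auto
  have "x \<noteq> 0" using assms by auto
  then obtain n :: int where n: "absval x = ?p powi n" using uniformizer(3) by blast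
  have 1: "int k \<le> n"
  proof (rule ccontr)
    assume "\<not> int k \<le> n"
    then have "?p powi int k < ?p powi n" using p by (intro power_int_strict_decreasing) auto
    then show False using assms(1) n by (simp add: ideal_power_def)
  qed
  have 2: "n < int (Suc k)"
  proof (rule ccontr)
    assume "\<not> n < int (Suc k)"
    then have "?p powi n \<le> ?p powi int (Suc k)" using p by (intro power_int_decreasing) auto
    then show False using assms(2) n unfolding power_int_of_nat by (simp add: ideal_power_def)
  qed
  from 1 2 have "n = int k" by linarith
  then show ?thesis using n by simp
qed

lemma level_exists:
  assumes "(x::'k::nonarch_local_field_char_0) \<in> ideal_power 0" "x \<notin> ideal_power n"
  shows "\<exists>k<n. x \<in> ideal_power k \<and> x \<notin> ideal_power (Suc k)"
  using assms(2)
proof (induction n)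
  case (Suc n)
  then show ?case by (cases "x \<in> ideal_power n") (auto intro: less_SucI)
qed (use assms(1) in auto)

lemma ideal_power_Inter:
  assumes "\<And>n. (x::'k::nonarch_local_field_char_0) \<in> ideal_power n"
  shows "x = 0"
proof (rule ccontr)
  assume "x \<noteq> 0"
  then obtain n where "absval (uniformizer::'k) ^ n < absval x"
    using real_arch_pow_inv[of "absval x" "absval (uniformizer::'k)"] uniformizer(2)[where 'k='k] by auto
  then show False using assms[of n] by (simp add: ideal_power_def)
qed

lemma ideal_power_mult_cancel:
  assumes "absval (y::'k::nonarch_local_field_char_0) = absval (uniformizer::'k) ^ k"
  shows "y * x \<in> ideal_power (k + n) \<longleftrightarrow> x \<in> ideal_power n"
  using uniformizer(1)[where 'k='k] assms by (simp add: ideal_power_def absval_mult power_add)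

text \<open>Discreteness again: an absolute value below 1 is at most that of the uniformizer.\<close>

lemma ideal_power_1: "ideal_power (Suc 0) = (maximal_ideal :: 'k::nonarch_local_field_char_0 set)"
proof -
  have "x \<in> ideal_power (Suc 0)" if "absval x < 1" for x :: 'k
  proof (rule ccontr)
    assume "x \<notin> ideal_power (Suc 0)"
    moreover have "x \<in> ideal_power 0" using that by (simp add: ideal_power_def)
    ultimately show False using absval_level[of x 0] that by simp
  qed
  then show ?thesis using uniformizer(2)[where 'k='k] by (auto simp: ideal_power_def maximal_ideal_def)
qed

section \<open>Digit expansions\<close>

text \<open>The representative of the maximal ideal is taken to be \<open>0\<close>, so that membership in a power of the
  ideal can be read off the leading digits of an expansion.\<close>

lemma residue_transversal_exists:
  "\<exists>T :: 'k::nonarch_local_field_char_0 set. finite T \<and> card T = card (residue_field :: 'k set set) \<and> 0 \<in> T \<and>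
     T \<subseteq> ideal_power 0 \<and> (\<forall>x\<in>ideal_power 0. \<exists>!u. u \<in> T \<and> x - u \<in> ideal_power (Suc 0))"
proof -
  let ?R = "{(x, y :: 'k). x \<in> valuation_ring \<and> y \<in> valuation_ring \<and> x - y \<in> maximal_ideal}"
  have eqv: "equiv valuation_ring ?R"
    unfolding ideal_power_1[symmetric] ideal_power_0[symmetric]
  proof (rule equivI)
    show "trans {(x, y :: 'k). x \<in> ideal_power 0 \<and> y \<in> ideal_power 0 \<and> x - y \<in> ideal_power (Suc 0)}"
      by (rule transI) (auto dest: ideal_power_add)
  qed (auto intro!: refl_onI symI simp: ideal_power_diff_commute)
  define r where "r C = (if 0 \<in> C then 0 else SOME x :: 'k. x \<in> C)" for C
  have r: "r C \<in> C" if "C \<in> residue_field" for C :: "'k set"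
  proof -
    have "C \<noteq> {}" using that in_quotient_imp_non_empty[OF eqv] by (auto simp: residue_field_def)
    then show ?thesis by (auto simp: r_def some_in_eq)
  qed
  have inj: "inj_on r residue_field"
  proof (rule inj_onI)
    fix C D assume CD: "C \<in> residue_field" "D \<in> residue_field" "r C = r D"
    then have "r C \<in> C \<inter> D" using r by (metis IntI)
    then show "C = D" using quotient_disj[OF eqv] CD by (auto simp: residue_field_def)
  qed
  have cls: "?R `` {x} \<in> residue_field" if "x \<in> ideal_power 0" for x
    using that by (auto simp: residue_field_def quotient_def ideal_power_0)
  have 0: "0 \<in> r ` residue_field"
  proof
    show "?R `` {0} \<in> residue_field" by (rule cls) auto
    show "0 = r (?R `` {0})" by (auto simp: r_def valuation_ring_def maximal_ideal_def)
  qed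
  have sub: "C \<subseteq> ideal_power 0" if "C \<in> residue_field" for C :: "'k set"
    using in_quotient_imp_subset[OF eqv, of C] that unfolding residue_field_def ideal_power_0 by blast
  have ex: "\<exists>!u. u \<in> r ` residue_field \<and> x - u \<in> ideal_power (Suc 0)" if x: "x \<in> ideal_power 0" for x
  proof
    show "r (?R `` {x}) \<in> r ` residue_field \<and> x - r (?R `` {x}) \<in> ideal_power (Suc 0)"
      using r[OF cls[OF x]] cls[OF x] by (auto simp: ideal_power_1)
    fix u assume u: "u \<in> r ` residue_field \<and> x - u \<in> ideal_power (Suc 0)"
    then obtain C where C: "C \<in> residue_field" "u = r C" by auto
    then have "u \<in> C" using r by auto
    moreover have "u \<in> ?R `` {x}" using u sub[OF C(1)] \<open>u \<in> C\<close> x by (auto simp: ideal_power_1 ideal_power_0)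
    ultimately have "C = ?R `` {x}" using quotient_disj[OF eqv] C(1) cls[OF x] by (auto simp: residue_field_def)
    then show "u = r (?R `` {x})" using C by simp
  qed
  have "r ` residue_field \<subseteq> ideal_power 0" using r sub by blast
  then show ?thesis
    using 0 ex finite_imageI[OF finite_residue_field, of r] card_image[OF inj]
    by (intro exI[of _ "r ` residue_field"]) simp
qed

definition digits :: "'k::nonarch_local_field_char_0 set" where
  "digits = (SOME T. finite T \<and> card T = card (residue_field :: 'k set set) \<and> 0 \<in> T \<and>
     T \<subseteq> ideal_power 0 \<and> (\<forall>x\<in>ideal_power 0. \<exists>!u. u \<in> T \<and> x - u \<in> ideal_power (Suc 0)))"

lemma digits:
  "finite (digits :: 'k::nonarch_local_field_char_0 set)"
  "card (digits :: 'k set) = card (residue_field :: 'k set set)"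
  "0 \<in> (digits :: 'k set)"
  "digits \<subseteq> (ideal_power 0 :: 'k set)"
  "(x::'k) \<in> ideal_power 0 \<Longrightarrow> \<exists>!u. u \<in> digits \<and> x - u \<in> ideal_power (Suc 0)"
  using someI_ex[OF residue_transversal_exists[where 'k='k]] unfolding digits_def[symmetric] by auto

lemma digits_unique:
  assumes "u \<in> digits" "u' \<in> digits" "u - (u'::'k::nonarch_local_field_char_0) \<in> ideal_power (Suc 0)"
  shows "u = u'"
proof -
  have "u \<in> ideal_power 0" using assms(1) digits(4) by blast
  moreover have "u - u \<in> ideal_power (Suc 0)" by simp
  ultimately show ?thesis using digits(5)[of u] assms by blast
qed

lemma residue_card_ge_2: "2 \<le> card (residue_field :: 'k::nonarch_local_field_char_0 set set)"
proof -
  obtain u :: 'k where u: "u \<in> digits" "1 - u \<in> ideal_power (Suc 0)"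
    using digits(5)[of 1] by auto
  have "1 \<notin> (ideal_power (Suc 0) :: 'k set)" by (simp add: ideal_power_1 maximal_ideal_def)
  then have "u \<noteq> 0" using u by auto
  then have "card {0, u} = 2" by simp
  moreover have "card {0, u} \<le> card (digits :: 'k set)"
    using u digits(1,3) by (intro card_mono) auto
  ultimately show ?thesis using digits(2)[where 'k='k] by simp
qed

text \<open>Sums of \<open>n\<close> digits times the powers of the uniformizer.  They represent the valuation ring modulo
  the \<open>n\<close>-th power of the maximal ideal, and every passage between the field and finite
  combinatorics below goes through them.\<close>

primrec expansions :: "nat \<Rightarrow> 'k::nonarch_local_field_char_0 set" where
  "expansions 0 = {0}"
| "expansions (Suc n) = (\<lambda>(u, s). u + uniformizer * s) ` (digits \<times> expansions n)"

lemma finite_expansions [simp]: "finite (expansions n :: 'k::nonarch_local_field_char_0 set)"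
  by (induction n) (auto simp: digits)

lemma uniformizer_mult_iff:
  "uniformizer * x \<in> ideal_power (Suc n) \<longleftrightarrow> (x::'k::nonarch_local_field_char_0) \<in> ideal_power n"
  using ideal_power_mult_cancel[of uniformizer 1 x n] by simp

lemma expansions_subset: "expansions n \<subseteq> (ideal_power 0 :: 'k::nonarch_local_field_char_0 set)"
proof (induction n)
  case (Suc n)
  show ?case
  proof
    fix x :: 'k assume "x \<in> expansions (Suc n)"
    then obtain u s where us: "x = u + uniformizer * s" "u \<in> digits" "s \<in> expansions n" by auto
    have "uniformizer * s \<in> ideal_power (Suc 0)" using us Suc by (auto simp: uniformizer_mult_iff)
    then have "uniformizer * s \<in> ideal_power 0" using ideal_power_antimono[of 0 "Suc 0"] by auto
    then show "x \<in> ideal_power 0" using us digits(4) by (auto intro: ideal_power_add)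
  qed
qed simp

lemma expansions_unique:
  assumes "s \<in> expansions n" "s' \<in> expansions n" "s - (s'::'k::nonarch_local_field_char_0) \<in> ideal_power n"
  shows "s = s'"
  using assms
proof (induction n arbitrary: s s')
  case (Suc n)
  obtain u v where s: "s = u + uniformizer * v" "u \<in> digits" "v \<in> expansions n" using Suc.prems by auto
  obtain u' v' where s': "s' = u' + uniformizer * v'" "u' \<in> digits" "v' \<in> expansions n" using Suc.prems by auto
  have eq: "s - s' = (u - u') + uniformizer * (v - v')" using s s' by (simp add: algebra_simps)
  have "v - v' \<in> ideal_power 0" using s s' expansions_subset by (intro ideal_power_diff) auto
  then have *: "uniformizer * (v - v') \<in> ideal_power (Suc 0)" by (simp add: uniformizer_mult_iff)
  have "s - s' \<in> ideal_power (Suc 0)" using Suc.prems ideal_power_antimono[of "Suc 0" "Suc n"] by auto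
  then have "(u - u') \<in> ideal_power (Suc 0)" using ideal_power_diff[OF _ *] eq by fastforce
  then have "u = u'" using digits_unique s s' by blast
  then have "v - v' \<in> ideal_power n" using eq Suc.prems by (simp add: uniformizer_mult_iff)
  then show ?case using Suc.IH s s' \<open>u = u'\<close> by auto
qed auto

lemma expansions_exists:
  assumes "(x::'k::nonarch_local_field_char_0) \<in> ideal_power 0"
  shows "\<exists>s\<in>expansions n. x - s \<in> ideal_power n"
  using assms
proof (induction n arbitrary: x)
  case (Suc n)
  obtain u where u: "u \<in> digits" "x - u \<in> ideal_power (Suc 0)" using digits(5)[OF Suc.prems] by auto
  define y where "y = (x - u) / uniformizer"
  have y: "x - u = uniformizer * y" by (simp add: y_def)
  then have "y \<in> ideal_power 0" using u uniformizer_mult_iff by metis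
  then obtain s where s: "s \<in> expansions n" "y - s \<in> ideal_power n" using Suc.IH by blast
  have "x - (u + uniformizer * s) = uniformizer * (y - s)" using y by (simp add: algebra_simps)
  then have "x - (u + uniformizer * s) \<in> ideal_power (Suc n)" using s by (simp add: uniformizer_mult_iff)
  moreover have "u + uniformizer * s \<in> expansions (Suc n)" using u s by auto
  ultimately show ?case by blast
qed auto

text \<open>An expansion lies in the \<open>l\<close>-th power of the ideal iff its first \<open>l\<close> digits vanish, so \<open>n - l\<close> digits
  remain free.\<close>

lemma card_expansions_in_ideal_power:
  assumes "l \<le> n"
  shows "card (expansions n \<inter> (ideal_power l :: 'k::nonarch_local_field_char_0 set))
    = card (residue_field :: 'k set set) ^ (n - l)"
  using assms
proof (induction n arbitrary: l)
  case (Suc n)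
  have inj: "inj_on (\<lambda>(u, s). u + uniformizer * s) (digits \<times> (expansions n :: 'k set))"
  proof (rule inj_onI, clarify)
    fix u s u' s' :: 'k
    assume A: "u \<in> digits" "s \<in> expansions n" "u' \<in> digits" "s' \<in> expansions n"
      "u + uniformizer * s = u' + uniformizer * s'"
    have "s' - s \<in> ideal_power 0" using A expansions_subset by (intro ideal_power_diff) auto
    then have "uniformizer * (s' - s) \<in> ideal_power (Suc 0)" by (simp add: uniformizer_mult_iff)
    moreover have "u - u' = uniformizer * (s' - s)" using A by (simp add: algebra_simps)
    ultimately have "u - u' \<in> ideal_power (Suc 0)" by simp
    then have "u = u'" using digits_unique A by blast
    then show "u = u' \<and> s = s'" using A by auto
  qed
  show ?case
  proof (cases l)
    case 0
    have "card (expansions (Suc n) :: 'k set) = card (digits :: 'k set) * card (expansions n :: 'k set)"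
      by (simp only: expansions.simps card_image[OF inj] card_cartesian_product)
    moreover have "expansions m \<inter> ideal_power 0 = (expansions m :: 'k set)" for m
      using expansions_subset by blast
    ultimately show ?thesis using Suc.IH[of 0] 0 by (simp add: digits(2) del: expansions.simps)
  next
    case (Suc l')
    have "expansions (Suc n) \<inter> ideal_power l = (\<lambda>s. uniformizer * s :: 'k) ` (expansions n \<inter> ideal_power l')"
    proof (intro equalityI subsetI)
      fix x :: 'k assume x: "x \<in> expansions (Suc n) \<inter> ideal_power l"
      then obtain u s where us: "x = u + uniformizer * s" "u \<in> digits" "s \<in> expansions n" by auto
      have "uniformizer * s \<in> ideal_power (Suc 0)" using us expansions_subset by (auto simp: uniformizer_mult_iff)
      moreover have "x \<in> ideal_power (Suc 0)" using x ideal_power_antimono[of "Suc 0" l] Suc by auto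
      ultimately have "u \<in> ideal_power (Suc 0)" using us ideal_power_diff[of x _ "uniformizer * s"] by simp
      then have "u = 0" using us digits(3) digits_unique[of u 0] by simp
      then show "x \<in> (\<lambda>s. uniformizer * s) ` (expansions n \<inter> ideal_power l')"
        using x us Suc by (auto simp: uniformizer_mult_iff)
    next
      fix x :: 'k assume "x \<in> (\<lambda>s. uniformizer * s) ` (expansions n \<inter> ideal_power l')"
      then obtain s where s: "x = uniformizer * s" "s \<in> expansions n" "s \<in> ideal_power l'" by auto
      then have "x \<in> ideal_power l" by (simp add: Suc uniformizer_mult_iff)
      moreover have "x \<in> expansions (Suc n)" using s digits(3) by force
      ultimately show "x \<in> expansions (Suc n) \<inter> ideal_power l" by blast
    qed
    then have "card (expansions (Suc n) \<inter> (ideal_power l :: 'k set)) = card (expansions n \<inter> (ideal_power l' :: 'k set))"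
      by (simp add: card_image inj_on_def)
    then show ?thesis using Suc.IH[of l'] Suc Suc.prems by simp
  qed
qed auto

declare expansions.simps(2) [simp del]

section \<open>Hensel's lemma and the approximation of zeros\<close>

lemma ideal_power_cong:
  assumes "x - y \<in> ideal_power n" "j \<le> n"
  shows "x \<in> ideal_power j \<longleftrightarrow> (y::'k::nonarch_local_field_char_0) \<in> ideal_power j"
proof -
  have d: "x - y \<in> ideal_power j" using assms ideal_power_antimono by blast
  show ?thesis using ideal_power_add[OF d, of y] ideal_power_diff[OF _ d, of x] by auto
qed

text \<open>First-order Taylor formulas with integral remainders, for \<open>f\<close> and its derivative \<open>f'\<close>, on the
  valuation ring.  They are what Newton's method uses, and they pass from monomials to integral
  linear combinations.\<close>

definition taylor_pair ::
    "('k::nonarch_local_field_char_0 \<Rightarrow> 'k) \<Rightarrow> ('k \<Rightarrow> 'k) \<Rightarrow> bool" where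
  "taylor_pair f f' \<longleftrightarrow> (\<forall>x\<in>ideal_power 0. \<forall>y\<in>ideal_power 0.
     f' x \<in> ideal_power 0 \<and> (\<exists>r\<in>ideal_power 0. f' y = f' x + (y - x) * r) \<and>
     (\<exists>r\<in>ideal_power 0. f y = f x + f' x * (y - x) + (y - x)\<^sup>2 * r))"

lemma taylor_pairD:
  fixes x y :: "'k::nonarch_local_field_char_0"
  assumes "taylor_pair f f'" "x \<in> ideal_power 0" "y \<in> ideal_power 0"
  shows "f' x \<in> ideal_power 0" "\<exists>r\<in>ideal_power 0. f' y = f' x + (y - x) * r"
    "\<exists>r\<in>ideal_power 0. f y = f x + f' x * (y - x) + (y - x)\<^sup>2 * r"
  using assms unfolding taylor_pair_def by blast+

text \<open>If the level of \<open>f'(x0)\<close> is \<open>k < n\<close> and \<open>f(x0)\<close> is of level \<open>k + n\<close>, the simplified Newton map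
  \<open>x \<mapsto> x - f x / f' x0\<close> maps the ball of radius \<open>n\<close> around \<open>x0\<close> into itself and contracts it at least by the
  absolute value of the uniformizer; its fixed points are the zeros of \<open>f\<close>.\<close>

lemma hensel:
  fixes x0 :: "'k::nonarch_local_field_char_0"
  assumes tp: "taylor_pair f f'" and x0: "x0 \<in> ideal_power 0" and kn: "k < n"
    and d: "f' x0 \<in> ideal_power k" "f' x0 \<notin> ideal_power (Suc k)"
    and f: "f x0 \<in> ideal_power (k + n)"
  shows "\<exists>!z. z - x0 \<in> ideal_power n \<and> f z = 0"
proof -
  let ?p = "absval (uniformizer :: 'k)"
  define d where "d = f' x0"
  define \<phi> where "\<phi> x = x - f x / d" for x
  define B where "B = {z. z - x0 \<in> ideal_power n}"
  have p: "0 < ?p" "?p < 1" using uniformizer[where 'k='k] by auto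
  have abs_d: "absval d = ?p ^ k" using absval_level assms(4,5) d_def by blast
  then have d0: "d \<noteq> 0" using p by auto
  have B0: "x \<in> ideal_power 0" if "x \<in> B" for x
    using that ideal_power_cong[of x x0 n 0] x0 by (auto simp: B_def)
  have x0B: "x0 \<in> B" by (simp add: B_def)
  have contr: "absval (\<phi> y - \<phi> x) \<le> ?p * absval (y - x)" if xy: "x \<in> B" "y \<in> B" for x y
  proof -
    obtain r where r: "r \<in> ideal_power 0" "f' x0 = f' x + (x0 - x) * r"
      using taylor_pairD(2)[OF tp B0[OF xy(1)] x0] by blast
    obtain s where s: "s \<in> ideal_power 0" "f y = f x + f' x * (y - x) + (y - x)\<^sup>2 * s"
      using taylor_pairD(3)[OF tp B0[OF xy(1)] B0[OF xy(2)]] by blast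
    \<comment> \<open>The Taylor formulas show that the difference is a product of \<open>y - x\<close> with a quantity of level \<open>n\<close>,
      whereas division by \<open>d\<close> costs only \<open>k < n\<close> levels.\<close>
    have "d * (\<phi> y - \<phi> x) = d * (y - x) - (f y - f x)"
      using d0 by (simp add: \<phi>_def field_simps)
    also have "\<dots> = (y - x) * ((x0 - x) * r - (y - x) * s)"
      unfolding s(2) d_def r(2) by (simp add: algebra_simps power2_eq_square)
    finally have eq: "d * (\<phi> y - \<phi> x) = (y - x) * ((x0 - x) * r - (y - x) * s)" .
    have "x0 - x \<in> ideal_power n" using xy by (simp add: B_def ideal_power_diff_commute)
    moreover have "y - x \<in> ideal_power n"
      using xy ideal_power_diff[of "y - x0" n "x - x0"] by (simp add: B_def)
    ultimately have "(x0 - x) * r - (y - x) * s \<in> ideal_power n"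
      using r s by (intro ideal_power_diff) (metis ideal_power_0_mult mult.commute)+
    then have "?p ^ k * absval (\<phi> y - \<phi> x) \<le> absval (y - x) * ?p ^ n"
      using arg_cong[OF eq, of absval] abs_d
      by (simp add: absval_mult ideal_power_def mult_left_mono)
    also have "\<dots> \<le> absval (y - x) * ?p ^ Suc k"
      using kn p by (intro mult_left_mono power_decreasing) auto
    finally show ?thesis using p by (simp add: field_simps)
  qed
  have fix_iff: "\<phi> z = z \<longleftrightarrow> f z = 0" for z using d0 by (simp add: \<phi>_def)
  have "\<exists>!z\<in>B. \<phi> z = z"
  proof (rule Banach_fix[of _ ?p])
    have "B = cball x0 (?p ^ n)"
      by (auto simp: B_def ideal_power_def dist_absval absval_minus_commute)
    then show "Topological_Spaces.complete B" by (simp add: complete_eq_closed)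
    show "\<phi> ` B \<subseteq> B"
    proof clarify
      fix x assume x: "x \<in> B"
      have "absval (\<phi> x - \<phi> x0) \<le> 1 * absval (x - x0)"
        using contr[OF x0B x] p mult_right_mono[of ?p 1 "absval (x - x0)"] by simp
      then have "\<phi> x - \<phi> x0 \<in> ideal_power n" using x by (simp add: B_def ideal_power_def)
      moreover have "d * (\<phi> x0 - x0) \<in> ideal_power (k + n)" using f d0 by (simp add: \<phi>_def)
      then have "\<phi> x0 - x0 \<in> ideal_power n" using ideal_power_mult_cancel[OF abs_d] by blast
      ultimately show "\<phi> x \<in> B" using ideal_power_add[of "\<phi> x - \<phi> x0"] by (fastforce simp: B_def)
    qed
    show "dist (\<phi> x) (\<phi> y) \<le> ?p * dist x y" if "x \<in> B" "y \<in> B" for x y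
      using contr that by (simp add: dist_absval)
  qed (use p x0B in auto)
  then show ?thesis by (simp add: fix_iff B_def)
qed

text \<open>The representatives modulo the \<open>n\<close>-th power to which \<open>hensel\<close> applies.  Membership depends only on
  the levels of finitely many values of \<open>f\<close> and \<open>f'\<close>, which makes the count of these points a
  random variable with a computable mean.\<close>

definition approx_zeros ::
    "('k::nonarch_local_field_char_0 \<Rightarrow> 'k) \<Rightarrow> ('k \<Rightarrow> 'k) \<Rightarrow> nat \<Rightarrow> nat \<Rightarrow> 'k set" where
  "approx_zeros f f' l n = {x \<in> expansions n \<inter> ideal_power l. \<exists>k<n.
     f' x \<in> ideal_power k \<and> f' x \<notin> ideal_power (Suc k) \<and> f x \<in> ideal_power (k + n)}"

lemma finite_approx_zeros [simp]: "finite (approx_zeros f f' l n)"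
  by (auto simp: approx_zeros_def)

text \<open>A zero at which the derivative is not of level \<open>n\<close> is matched with its representative modulo the
  \<open>n\<close>-th power.  By \<open>hensel\<close>, each approximate zero represents exactly one zero; the derivative has
  the same level at both, since this level is below \<open>n\<close>.\<close>

lemma bij_betw_zeros_approx_zeros:
  fixes f :: "'k::nonarch_local_field_char_0 \<Rightarrow> 'k"
  assumes tp: "taylor_pair f f'" and ln: "l \<le> n"
  shows "\<exists>g. bij_betw g {z \<in> ideal_power l. f z = 0 \<and> f' z \<notin> ideal_power n} (approx_zeros f f' l n)"
proof -
  let ?Z = "{z \<in> ideal_power l. f z = 0 \<and> f' z \<notin> ideal_power n}"
  define g where "g z = (SOME s. s \<in> expansions n \<and> z - s \<in> ideal_power n)" for z :: 'k
  have g: "g z \<in> expansions n" "z - g z \<in> ideal_power n" if "z \<in> ideal_power 0" for z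
    using expansions_exists[OF that, of n] someI_ex[of "\<lambda>s. s \<in> expansions n \<and> z - s \<in> ideal_power n"]
    unfolding g_def by blast+
  have in0: "z \<in> ideal_power 0" if "z \<in> ideal_power l" for z :: 'k
    using that ideal_power_antimono[of 0 l] by auto
  have good: "g z \<in> approx_zeros f f' l n" if z: "z \<in> ?Z" for z
  proof -
    have z0: "z \<in> ideal_power 0" using in0 z by simp
    define s where "s = g z"
    have s: "s \<in> expansions n" "z - s \<in> ideal_power n" using g[OF z0] by (auto simp: s_def)
    have s0: "s \<in> ideal_power 0" using s expansions_subset by auto
    obtain k where k: "k < n" "f' z \<in> ideal_power k" "f' z \<notin> ideal_power (Suc k)"
      using level_exists[of "f' z" n] taylor_pairD(1)[OF tp z0 z0] z by auto
    obtain r where r: "r \<in> ideal_power 0" "f' s = f' z + (s - z) * r"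
      using taylor_pairD(2)[OF tp z0 s0] by blast
    obtain t where t: "t \<in> ideal_power 0" "f s = f z + f' z * (s - z) + (s - z)\<^sup>2 * t"
      using taylor_pairD(3)[OF tp z0 s0] by blast
    have sz: "s - z \<in> ideal_power n" using s by (simp add: ideal_power_diff_commute)
    have "f' s - f' z \<in> ideal_power n" using r sz ideal_power_0_mult[of r "s - z" n] by (simp add: mult.commute)
    then have 1: "f' s \<in> ideal_power k" "f' s \<notin> ideal_power (Suc k)"
      using k ideal_power_cong[of "f' s" "f' z" n] by (auto simp: Suc_le_eq)
    have "(s - z) * (t * (s - z)) \<in> ideal_power (n + n)"
      using sz t by (intro ideal_power_mult ideal_power_0_mult) auto
    then have "(s - z)\<^sup>2 * t \<in> ideal_power (n + n)" by (simp add: power2_eq_square mult_ac)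
    then have "(s - z)\<^sup>2 * t \<in> ideal_power (k + n)"
      using k ideal_power_antimono[of "k + n" "n + n"] by auto
    moreover have "f' z * (s - z) \<in> ideal_power (k + n)" using k sz by (intro ideal_power_mult) auto
    ultimately have "f s \<in> ideal_power (k + n)" using t z by (simp add: ideal_power_add)
    moreover have "s \<in> ideal_power l" using ideal_power_cong[OF s(2) ln] z by auto
    ultimately show ?thesis using 1 k s by (auto simp: approx_zeros_def s_def[symmetric])
  qed
  have "bij_betw g ?Z (approx_zeros f f' l n)"
    unfolding bij_betw_def
  proof
    have uniq: "z = z'" if "s \<in> approx_zeros f f' l n" "z - s \<in> ideal_power n" "z' - s \<in> ideal_power n" "f z = 0" "f z' = 0" for s z z'
      using that hensel[OF tp, of s _ n] expansions_subset[of n] by (auto simp: approx_zeros_def)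
    show "inj_on g ?Z"
      by (rule inj_onI) (metis (mono_tags, lifting) good g(2) in0 mem_Collect_eq uniq)
    show "g ` ?Z = approx_zeros f f' l n"
    proof
      show "approx_zeros f f' l n \<subseteq> g ` ?Z"
      proof
        fix s assume s: "s \<in> approx_zeros f f' l n"
        then obtain k where k: "s \<in> expansions n" "s \<in> ideal_power l" "k < n" "f' s \<in> ideal_power k"
           "f' s \<notin> ideal_power (Suc k)" "f s \<in> ideal_power (k + n)" by (auto simp: approx_zeros_def)
        have s0: "s \<in> ideal_power 0" using k in0 by auto
        obtain z where z: "z - s \<in> ideal_power n" "f z = 0" using hensel[OF tp s0 k(3-6)] by blast
        have zl: "z \<in> ideal_power l" using ideal_power_cong[OF z(1) ln] k by auto
        obtain r where r: "r \<in> ideal_power 0" "f' z = f' s + (z - s) * r"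
          using taylor_pairD(2)[OF tp s0 in0[OF zl]] by blast
        have "f' z - f' s \<in> ideal_power n" using r z ideal_power_0_mult[of r "z - s" n] by (simp add: mult.commute)
        then have "f' z \<notin> ideal_power n"
          using k ideal_power_cong[of "f' z" "f' s" n n] ideal_power_antimono[of "Suc k" n] by auto
        then have zZ: "z \<in> ?Z" using z zl by auto
        have "s - g z \<in> ideal_power n"
          using ideal_power_diff[OF g(2)[OF in0[OF zl]] z(1)] by simp
        then have "s = g z" using expansions_unique k(1) g(1)[OF in0[OF zl]] by blast
        then show "s \<in> g ` ?Z" using zZ by blast
      qed
    qed (use good in blast)
  qed
  then show ?thesis by blast
qed

lemma card_approx_zeros:
  assumes "taylor_pair f f'" "l \<le> n"
  shows "of_nat (card (approx_zeros f f' l n)) =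
    emeasure (count_space UNIV) {z \<in> ideal_power l. f z = 0 \<and> f' z \<notin> ideal_power n}"
proof -
  obtain g where g: "bij_betw g {z \<in> ideal_power l. f z = 0 \<and> f' z \<notin> ideal_power n} (approx_zeros f f' l n)"
    using bij_betw_zeros_approx_zeros[OF assms] by blast
  then have "finite {z \<in> ideal_power l. f z = 0 \<and> f' z \<notin> ideal_power n}"
    using bij_betw_finite finite_approx_zeros by blast
  then show ?thesis using bij_betw_same_card[OF g] by simp
qed

lemma incseq_card_approx_zeros:
  assumes "taylor_pair f f'"
  shows "incseq (\<lambda>n. of_nat (card (approx_zeros f f' l (n + Suc l))) :: ennreal)"
proof -
  have "ideal_power (n + Suc l) \<subseteq> (ideal_power (m + Suc l) :: 'a set)" if "m \<le> n" for m n
    using that by (intro ideal_power_antimono) auto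
  then show ?thesis
    by (auto simp: incseq_def card_approx_zeros[OF assms] intro!: emeasure_mono)
qed

text \<open>As \<open>n\<close> grows, the zeros counted modulo the \<open>n\<close>-th power exhaust the simple zeros.  The exponent starts at \<open>Suc l\<close>
  because a ball of radius \<open>l\<close> is a union of residue classes only from exponent \<open>l\<close> on; the
  further step lets the expected count separate the sphere from the next smaller ball.\<close>

lemma num_simple_zeros_eq_SUP:
  assumes tp: "taylor_pair f f'" and simple: "\<And>z. z \<in> ideal_power l \<Longrightarrow> f z = 0 \<Longrightarrow> f' z \<noteq> 0"
  shows "num_zeros f (ideal_power l) = (SUP n. of_nat (card (approx_zeros f f' l (n + Suc l))))"
proof -
  define Z where "Z n = {z \<in> ideal_power l. f z = 0 \<and> f' z \<notin> ideal_power (n + Suc l)}" for n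
  have "incseq Z"
    using ideal_power_antimono[of "m + Suc l" "n + Suc l" for m n, where 'k='a] unfolding incseq_def Z_def by fastforce
  then have "(SUP n. emeasure (count_space UNIV) (Z n)) = emeasure (count_space UNIV) (\<Union>n. Z n)"
    by (intro SUP_emeasure_incseq) auto
  also have "(\<Union>n. Z n) = {z \<in> ideal_power l. f z = 0}"
  proof (intro equalityI subsetI)
    fix z assume z: "z \<in> {z \<in> ideal_power l. f z = 0}"
    then obtain n where "f' z \<notin> ideal_power n" using ideal_power_Inter simple by blast
    then have "f' z \<notin> ideal_power (n + Suc l)"
      using ideal_power_antimono[of n "n + Suc l"] by auto
    then show "z \<in> (\<Union>n. Z n)" using z by (auto simp: Z_def)
  qed (auto simp: Z_def)
  finally show ?thesis
    by (simp add: num_zeros_def Z_def card_approx_zeros[OF tp])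
qed

text \<open>Near a double zero \<open>f\<close> is quadratically small.  This is the rare event which excludes double zeros
  almost surely.\<close>

lemma double_zero_approx:
  assumes tp: "taylor_pair f f'" and z: "z \<in> ideal_power 0" "f z = 0" "f' z = 0"
  shows "\<exists>s\<in>expansions n. f' s \<in> ideal_power n \<and> f s \<in> ideal_power (n + n)"
proof -
  obtain s where s: "s \<in> expansions n" "z - s \<in> ideal_power n" using expansions_exists z by blast
  have s0: "s \<in> ideal_power 0" using s expansions_subset by auto
  have sz: "s - z \<in> ideal_power n" using s by (simp add: ideal_power_diff_commute)
  obtain r where r: "r \<in> ideal_power 0" "f' s = f' z + (s - z) * r"
    using taylor_pairD(2)[OF tp z(1) s0] by blast
  obtain t where t: "t \<in> ideal_power 0" "f s = f z + f' z * (s - z) + (s - z)\<^sup>2 * t"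
    using taylor_pairD(3)[OF tp z(1) s0] by blast
  have "(s - z) * (t * (s - z)) \<in> ideal_power (n + n)"
    using sz t by (intro ideal_power_mult ideal_power_0_mult) auto
  then have "f s \<in> ideal_power (n + n)" using t z by (simp add: power2_eq_square mult_ac)
  moreover have "f' s \<in> ideal_power n" using r z sz ideal_power_0_mult[of r "s - z" n] by (simp add: mult.commute)
  ultimately show ?thesis using s by blast
qed

text \<open>The coefficient is the last factor, in agreement with the linear forms in the coefficients whose
  distribution is studied below.\<close>

definition poly_sum :: "nat set \<Rightarrow> (nat \<Rightarrow> nat) \<Rightarrow> (nat \<Rightarrow> 'k::field) \<Rightarrow> 'k \<Rightarrow> 'k" where
  "poly_sum J b c x = (\<Sum>j\<in>J. x ^ b j * c j)"

definition poly_sum_deriv :: "nat set \<Rightarrow> (nat \<Rightarrow> nat) \<Rightarrow> (nat \<Rightarrow> 'k::field) \<Rightarrow> 'k \<Rightarrow> 'k" where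
  "poly_sum_deriv J b c x = (\<Sum>j\<in>J. of_nat (b j) * x ^ (b j - 1) * c j)"

text \<open>If \<open>r\<close> is the quadratic remainder of the power \<open>b\<close>, then that of \<open>b + 1\<close> is
  \<open>b x^(b-1) + y r\<close>, which is again integral.\<close>

lemma taylor_pair_power:
  "taylor_pair (\<lambda>x. x ^ b) (\<lambda>x::'k::nonarch_local_field_char_0. of_nat b * x ^ (b - 1))"
proof -
  have first: "\<exists>r\<in>ideal_power 0. y ^ b = x ^ b + (y - x) * r"
    if "x \<in> ideal_power 0" "y \<in> ideal_power 0" for x y :: 'k and b
  proof (induction b)
    case (Suc b)
    then obtain r where r: "r \<in> ideal_power 0" "y ^ b = x ^ b + (y - x) * r" by blast
    have "y ^ Suc b = x ^ Suc b + (y - x) * (x ^ b + y * r)"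
      by (simp add: r algebra_simps)
    then show ?case using r that by (auto intro!: ideal_power_add ideal_power_0_mult ideal_power_0_power)
  qed auto
  have second: "\<exists>r\<in>ideal_power 0. y ^ b = x ^ b + of_nat b * x ^ (b - 1) * (y - x) + (y - x)\<^sup>2 * r"
    if "x \<in> ideal_power 0" "y \<in> ideal_power 0" for x y :: 'k
  proof (induction b)
    case (Suc b)
    then obtain r where r: "r \<in> ideal_power 0"
      "y ^ b = x ^ b + of_nat b * x ^ (b - 1) * (y - x) + (y - x)\<^sup>2 * r" by blast
    have x: "of_nat b * x ^ b = of_nat b * x ^ (b - 1) * x"
      by (cases b) simp_all
    have "y ^ Suc b = y * y ^ b" by simp
    also have "\<dots> = x * x ^ b + x ^ b * (y - x) + (of_nat b * x ^ (b - 1) * x) * (y - x)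
        + (y - x)\<^sup>2 * (of_nat b * x ^ (b - 1) + y * r)"
      unfolding r(2) by (simp add: algebra_simps power2_eq_square)
    also have "\<dots> = x ^ Suc b + of_nat (Suc b) * x ^ (Suc b - 1) * (y - x)
        + (y - x)\<^sup>2 * (of_nat b * x ^ (b - 1) + y * r)"
      unfolding x[symmetric] by (simp add: algebra_simps)
    finally show ?case using r that
      by (auto intro!: bexI[of _ "of_nat b * x ^ (b - 1) + y * r"] ideal_power_add ideal_power_0_mult ideal_power_0_power)
  qed auto
  have "\<exists>r\<in>ideal_power 0. of_nat b * y ^ (b - 1) = of_nat b * x ^ (b - 1) + (y - x) * r"
    if xy: "x \<in> ideal_power 0" "y \<in> ideal_power 0" for x y :: 'k
  proof -
    obtain r where r: "r \<in> ideal_power 0" "y ^ (b - 1) = x ^ (b - 1) + (y - x) * r"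
      using first[OF xy, of "b - 1"] by blast
    have "of_nat b * y ^ (b - 1) = of_nat b * x ^ (b - 1) + (y - x) * (of_nat b * r)"
      unfolding r(2) by (simp add: algebra_simps)
    then show ?thesis using r by (auto intro!: ideal_power_0_mult)
  qed
  then show ?thesis using second
    by (auto simp: taylor_pair_def intro!: ideal_power_0_mult ideal_power_0_power)
qed

lemma taylor_pair_scale:
  fixes f :: "'k::nonarch_local_field_char_0 \<Rightarrow> 'k"
  assumes "taylor_pair f f'" "c \<in> ideal_power 0"
  shows "taylor_pair (\<lambda>x. f x * c) (\<lambda>x. f' x * c)"
  unfolding taylor_pair_def
proof (intro ballI conjI)
  fix x y :: 'k assume xy: "x \<in> ideal_power 0" "y \<in> ideal_power 0"
  note D = taylor_pairD[OF assms(1) xy]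
  show "f' x * c \<in> ideal_power 0" using D(1) assms(2) by (rule ideal_power_0_mult)
  obtain r where r: "r \<in> ideal_power 0" "f' y = f' x + (y - x) * r" using D(2) by blast
  then show "\<exists>r\<in>ideal_power 0. f' y * c = f' x * c + (y - x) * r"
    unfolding r(2) using assms(2) by (intro bexI[of _ "r * c"]) (auto simp: algebra_simps intro: ideal_power_0_mult)
  obtain r where r: "r \<in> ideal_power 0" "f y = f x + f' x * (y - x) + (y - x)\<^sup>2 * r" using D(3) by blast
  then show "\<exists>r\<in>ideal_power 0. f y * c = f x * c + f' x * c * (y - x) + (y - x)\<^sup>2 * r"
    unfolding r(2) using assms(2) by (intro bexI[of _ "r * c"]) (auto simp: algebra_simps intro: ideal_power_0_mult)
qed

lemma taylor_pair_add:
  fixes f :: "'k::nonarch_local_field_char_0 \<Rightarrow> 'k"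
  assumes "taylor_pair f f'" "taylor_pair g g'"
  shows "taylor_pair (\<lambda>x. f x + g x) (\<lambda>x. f' x + g' x)"
  unfolding taylor_pair_def
proof (intro ballI conjI)
  fix x y :: 'k assume xy: "x \<in> ideal_power 0" "y \<in> ideal_power 0"
  note D = taylor_pairD[OF assms(1) xy] and E = taylor_pairD[OF assms(2) xy]
  show "f' x + g' x \<in> ideal_power 0" using D(1) E(1) by (rule ideal_power_add)
  obtain r s where "r \<in> ideal_power 0" "f' y = f' x + (y - x) * r"
    "s \<in> ideal_power 0" "g' y = g' x + (y - x) * s" using D(2) E(2) by blast
  then show "\<exists>r\<in>ideal_power 0. f' y + g' y = f' x + g' x + (y - x) * r"
    by (intro bexI[of _ "r + s"]) (auto simp: algebra_simps intro: ideal_power_add)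
  obtain r s where "r \<in> ideal_power 0" "f y = f x + f' x * (y - x) + (y - x)\<^sup>2 * r"
    "s \<in> ideal_power 0" "g y = g x + g' x * (y - x) + (y - x)\<^sup>2 * s" using D(3) E(3) by blast
  then show "\<exists>r\<in>ideal_power 0. f y + g y = f x + g x + (f' x + g' x) * (y - x) + (y - x)\<^sup>2 * r"
    by (intro bexI[of _ "r + s"]) (auto simp: algebra_simps intro: ideal_power_add)
qed

lemma taylor_pair_poly_sum:
  assumes "finite J" "\<And>j. j \<in> J \<Longrightarrow> c j \<in> ideal_power 0"
  shows "taylor_pair (poly_sum J b c) (poly_sum_deriv J b c)"
  using assms
proof (induction J rule: finite_induct)
  case empty
  show ?case by (auto simp: taylor_pair_def poly_sum_def poly_sum_deriv_def intro!: bexI[of _ 0])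
next
  case (insert j J)
  have "taylor_pair (\<lambda>x. x ^ b j * c j + poly_sum J b c x)
      (\<lambda>x. of_nat (b j) * x ^ (b j - 1) * c j + poly_sum_deriv J b c x)"
    using insert by (intro taylor_pair_add taylor_pair_scale taylor_pair_power) auto
  moreover have "poly_sum (insert j J) b c = (\<lambda>x. x ^ b j * c j + poly_sum J b c x)"
    "poly_sum_deriv (insert j J) b c = (\<lambda>x. of_nat (b j) * x ^ (b j - 1) * c j + poly_sum_deriv J b c x)"
    using insert by (auto simp: poly_sum_def poly_sum_deriv_def)
  ultimately show ?case by simp
qed

section \<open>Haar measure of balls and measurability on balls\<close>

lemma ball_in_borel: "{x. x - a \<in> ideal_power m} \<in> sets (borel :: 'k::nonarch_local_field_char_0 measure)"
proof -
  have "{x. x - a \<in> ideal_power m} = cball a (absval (uniformizer::'k) ^ m)"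
    by (auto simp: ideal_power_def dist_absval absval_minus_commute)
  then show ?thesis by simp
qed

lemma ball_subset_ideal_power_0:
  assumes "a \<in> ideal_power 0"
  shows "{x. x - a \<in> ideal_power m} \<subseteq> (ideal_power 0 :: 'k::nonarch_local_field_char_0 set)"
  using ideal_power_cong[of _ a m 0] assms by auto

lemma ideal_power_0_in_borel: "ideal_power 0 \<in> sets (borel :: 'k::nonarch_local_field_char_0 measure)"
  using ball_in_borel[of 0 0] by simp

lemma ball_in_restrict_space:
  "{x. x - a \<in> ideal_power m} \<inter> ideal_power 0 \<in>
    sets (restrict_space borel (valuation_ring :: 'k::nonarch_local_field_char_0 set))"
  using ball_in_borel[of a m] ideal_power_0_in_borel[where 'k='k]
  by (simp add: ideal_power_0[symmetric] sets_restrict_space_iff)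

text \<open>The residue classes modulo the \<open>m\<close>-th power of the ideal are translates of each other, and they
  partition a space of total mass one.\<close>

lemma measure_ball:
  fixes \<mu> :: "'k::nonarch_local_field_char_0 measure"
  assumes haar: "normalized_haar_measure \<mu>" and a: "a \<in> ideal_power 0"
  shows "measure \<mu> {x. x - a \<in> ideal_power m} = inverse (real (card (residue_field :: 'k set set))) ^ m"
proof -
  let ?B = "\<lambda>a. {x :: 'k. x - a \<in> ideal_power m}"
  interpret prob_space \<mu> using haar by (intro prob_spaceI) (auto simp: normalized_haar_measure_def)
  have sets: "sets \<mu> = sets (restrict_space borel valuation_ring)"
    using haar by (simp add: normalized_haar_measure_def)
  then have sp: "space \<mu> = ideal_power 0"
    using sets_eq_imp_space_eq[OF sets] by (simp add: space_restrict_space ideal_power_0)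
  have B: "?B s \<in> sets \<mu>" if "s \<in> ideal_power 0" for s
    using ball_in_restrict_space[of s m] ball_subset_ideal_power_0[OF that] sets by (simp add: Int_absorb2)
  have eq: "measure \<mu> (?B s) = measure \<mu> (?B 0)" if s: "s \<in> ideal_power 0" for s
  proof -
    have "?B s = (\<lambda>x. s + x) ` ?B 0"
      by (auto intro!: image_eqI[of _ _ "_ - s"])
    then have "emeasure \<mu> (?B s) = emeasure \<mu> (?B 0)"
      using haar B[OF zero_in_ideal_power] s by (simp add: normalized_haar_measure_def ideal_power_0)
    then show ?thesis by (simp add: measure_def)
  qed
  have "1 = measure \<mu> (\<Union>s\<in>expansions m. ?B s)"
  proof -
    have "(\<Union>s\<in>expansions m. ?B s) = space \<mu>"
      using expansions_exists[of _ m, where 'k='k] ball_subset_ideal_power_0[where 'k='k]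
        expansions_subset[of m, where 'k='k] unfolding sp by blast
    then show ?thesis by (simp add: prob_space)
  qed
  also have "\<dots> = (\<Sum>s\<in>expansions m. measure \<mu> (?B s))"
  proof (rule finite_measure_finite_Union)
    show "disjoint_family_on ?B (expansions m)"
    proof (auto simp: disjoint_family_on_def)
      fix s s' x :: 'k assume s: "s \<in> expansions m" "s' \<in> expansions m" "s \<noteq> s'"
        "x - s \<in> ideal_power m" "x - s' \<in> ideal_power m"
      have "s - s' \<in> ideal_power m" using ideal_power_diff[OF s(5) s(4)] by simp
      then show False using expansions_unique s by blast
    qed
  qed (use B expansions_subset in auto)
  also have "\<dots> = real (card (expansions m :: 'k set)) * measure \<mu> (?B 0)"
    using eq expansions_subset by (subst sum.cong[OF refl eq]) auto
  also have "card (expansions m :: 'k set) = card (residue_field :: 'k set set) ^ m"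
    using card_expansions_in_ideal_power[of 0 m, where 'k='k] expansions_subset[of m, where 'k='k]
    by (simp add: Int_absorb2)
  finally have "measure \<mu> (?B 0) = inverse (real (card (residue_field :: 'k set set))) ^ m"
    using residue_card_ge_2[where 'k='k] by (simp add: field_simps)
  then show ?thesis using eq[OF a] by simp
qed

text \<open>Measurability tested on balls alone.  A sum or an integral multiple modulo a power of the ideal is
  determined by finitely many residues of its arguments, so this class is closed under integral
  linear combinations: the required sets are finite unions of sets already known to be measurable.\<close>

definition ball_measurable :: "'w measure \<Rightarrow> ('w \<Rightarrow> 'k::nonarch_local_field_char_0) \<Rightarrow> bool" where
  "ball_measurable N h \<longleftrightarrow> (\<forall>v\<in>space N. h v \<in> ideal_power 0) \<and>
     (\<forall>a m. {v\<in>space N. h v - a \<in> ideal_power m} \<in> sets N)"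

lemma ball_measurableD:
  assumes "ball_measurable N h"
  shows "v \<in> space N \<Longrightarrow> h v \<in> ideal_power 0"
    "{v\<in>space N. h v - a \<in> ideal_power m} \<in> sets N"
    "{v\<in>space N. h v \<in> ideal_power m} \<in> sets N"
proof -
  show 1: "{v\<in>space N. h v - a \<in> ideal_power m} \<in> sets N" for a using assms by (simp add: ball_measurable_def)
  show "{v\<in>space N. h v \<in> ideal_power m} \<in> sets N" using 1[of 0] by simp
qed (use assms in \<open>simp add: ball_measurable_def\<close>)

lemma ball_measurable_zero: "ball_measurable N (\<lambda>v. 0)"
  by (auto simp: ball_measurable_def intro: sets.sets_Collect_const)

lemma ball_measurable_add:
  assumes g: "ball_measurable N g" and h: "ball_measurable N h"
  shows "ball_measurable N (\<lambda>v. g v + h v)"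
  unfolding ball_measurable_def
proof (intro conjI ballI allI)
  show "g v + h v \<in> ideal_power 0" if "v \<in> space N" for v
    using ball_measurableD(1)[OF g that] ball_measurableD(1)[OF h that] by (rule ideal_power_add)
  fix a m
  have "{v\<in>space N. g v + h v - a \<in> ideal_power m} =
      {v\<in>space N. \<exists>s\<in>expansions m. g v - s \<in> ideal_power m \<and> h v - (a - s) \<in> ideal_power m}"
  proof (intro equalityI subsetI)
    fix v assume v: "v \<in> {v\<in>space N. g v + h v - a \<in> ideal_power m}"
    obtain s where s: "s \<in> expansions m" "g v - s \<in> ideal_power m"
      using expansions_exists ball_measurableD(1)[OF g] v by blast
    have "h v - (a - s) = (g v + h v - a) - (g v - s)" by simp
    then have "h v - (a - s) \<in> ideal_power m" using v s(2) ideal_power_diff by (metis (mono_tags, lifting) mem_Collect_eq)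
    then show "v \<in> {v\<in>space N. \<exists>s\<in>expansions m. g v - s \<in> ideal_power m \<and> h v - (a - s) \<in> ideal_power m}"
      using v s by blast
  next
    fix v assume "v \<in> {v\<in>space N. \<exists>s\<in>expansions m. g v - s \<in> ideal_power m \<and> h v - (a - s) \<in> ideal_power m}"
    then obtain s where s: "v \<in> space N" "g v - s \<in> ideal_power m" "h v - (a - s) \<in> ideal_power m" by blast
    then show "v \<in> {v\<in>space N. g v + h v - a \<in> ideal_power m}"
      using ideal_power_add[OF s(2,3)] by (simp add: algebra_simps)
  qed
  also have "\<dots> \<in> sets N"
    by (intro sets.sets_Collect_finite_Ex sets.sets_Collect_conj ball_measurableD(2) g h finite_expansions)
  finally show "{v\<in>space N. g v + h v - a \<in> ideal_power m} \<in> sets N" .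
qed

lemma ball_measurable_scale:
  assumes h: "ball_measurable N h" and e: "e \<in> ideal_power 0"
  shows "ball_measurable N (\<lambda>v. e * h v)"
  unfolding ball_measurable_def
proof (intro conjI ballI allI)
  show "e * h v \<in> ideal_power 0" if "v \<in> space N" for v
    using ball_measurableD(1)[OF h that] e by (intro ideal_power_0_mult)
  fix a m
  have eq: "e * h v - a \<in> ideal_power m \<longleftrightarrow> e * s - a \<in> ideal_power m" if "h v - s \<in> ideal_power m" for v s
  proof -
    have "(e * h v - a) - (e * s - a) = e * (h v - s)" by (simp add: algebra_simps)
    also have "\<dots> \<in> ideal_power m" using e that by (rule ideal_power_0_mult)
    finally show ?thesis using ideal_power_cong by blast
  qed
  have "{v\<in>space N. e * h v - a \<in> ideal_power m} =
      {v\<in>space N. \<exists>s\<in>expansions m. h v - s \<in> ideal_power m \<and> e * s - a \<in> ideal_power m}"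
  proof (intro equalityI subsetI)
    fix v assume v: "v \<in> {v\<in>space N. e * h v - a \<in> ideal_power m}"
    obtain s where s: "s \<in> expansions m" "h v - s \<in> ideal_power m"
      using expansions_exists ball_measurableD(1)[OF h] v by blast
    then show "v \<in> {v\<in>space N. \<exists>s\<in>expansions m. h v - s \<in> ideal_power m \<and> e * s - a \<in> ideal_power m}"
      using v eq by blast
  qed (use eq in blast)
  also have "\<dots> \<in> sets N"
    by (intro sets.sets_Collect_finite_Ex sets.sets_Collect_conj ball_measurableD(2) h
        finite_expansions sets.sets_Collect_const)
  finally show "{v\<in>space N. e * h v - a \<in> ideal_power m} \<in> sets N" .
qed

lemma ball_measurable_linear_form:
  assumes "finite I" "\<And>j. j \<in> I \<Longrightarrow> ball_measurable N (X j)" "\<And>j. j \<in> I \<Longrightarrow> e j \<in> ideal_power 0"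
  shows "ball_measurable N (\<lambda>v. \<Sum>j\<in>I. e j * X j v)"
  using assms
proof (induction I rule: finite_induct)
  case (insert i I)
  have "ball_measurable N (\<lambda>v. e i * X i v + (\<Sum>j\<in>I. e j * X j v))"
    using insert by (intro ball_measurable_add[OF ball_measurable_scale]) auto
  then show ?case using insert by simp
qed (simp add: ball_measurable_zero)

lemma ball_measurable_compose:
  assumes "X \<in> measurable N (restrict_space borel (valuation_ring :: 'k::nonarch_local_field_char_0 set))"
  shows "ball_measurable N X"
proof -
  have R: "X v \<in> ideal_power 0" if "v \<in> space N" for v
    using measurable_space[OF assms that] by (simp add: space_restrict_space ideal_power_0)
  have "{v\<in>space N. X v - a \<in> ideal_power m} = X -` ({x. x - a \<in> ideal_power m} \<inter> ideal_power 0) \<inter> space N" for a m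
    using R by auto
  then have "{v\<in>space N. X v - a \<in> ideal_power m} \<in> sets N" for a m
    using measurable_sets[OF assms ball_in_restrict_space] by metis
  then show ?thesis using R by (simp add: ball_measurable_def)
qed

text \<open>The law of total probability for the residue of \<open>h\<close>.\<close>

lemma (in prob_space) prob_partition:
  assumes E: "E \<in> events" and h: "ball_measurable M h"
  shows "prob E = (\<Sum>s\<in>expansions m. prob {\<omega>\<in>E. h \<omega> - s \<in> ideal_power m})"
proof -
  have sub: "E \<subseteq> space M" using E sets.sets_into_space by blast
  have "E = (\<Union>s\<in>expansions m. {\<omega>\<in>E. h \<omega> - s \<in> ideal_power m})"
    using sub expansions_exists[of _ m] ball_measurableD(1)[OF h] by blast
  then have "prob E = prob (\<Union>s\<in>expansions m. {\<omega>\<in>E. h \<omega> - s \<in> ideal_power m})" by simp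
  also have "\<dots> = (\<Sum>s\<in>expansions m. prob {\<omega>\<in>E. h \<omega> - s \<in> ideal_power m})"
  proof (rule finite_measure_finite_Union)
    have "{\<omega>\<in>E. h \<omega> - s \<in> ideal_power m} = E \<inter> {\<omega>\<in>space M. h \<omega> - s \<in> ideal_power m}" for s
      using sub by auto
    then show "(\<lambda>s. {\<omega>\<in>E. h \<omega> - s \<in> ideal_power m}) ` expansions m \<subseteq> events"
      using E ball_measurableD(2)[OF h] by auto
    show "disjoint_family_on (\<lambda>s. {\<omega>\<in>E. h \<omega> - s \<in> ideal_power m}) (expansions m)"
    proof (auto simp: disjoint_family_on_def)
      fix s s' \<omega> assume s: "s \<in> expansions m" "s' \<in> expansions m" "s \<noteq> s'"
        "h \<omega> - s \<in> ideal_power m" "h \<omega> - s' \<in> ideal_power m"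
      have "s - s' \<in> ideal_power m" using ideal_power_diff[OF s(5) s(4)] by simp
      then show False using expansions_unique s by blast
    qed
  qed auto
  finally show ?thesis .
qed

section \<open>Linear forms in independent uniform coefficients\<close>

locale uniform_coefficients = prob_space M for M :: "'w measure" +
  fixes c :: "nat \<Rightarrow> 'w \<Rightarrow> 'k::nonarch_local_field_char_0" and J :: "nat set" and \<epsilon> :: real
  assumes finite_J: "finite J"
    and indep: "indep_vars (\<lambda>_. restrict_space borel valuation_ring) c J"
    and uniform: "j \<in> J \<Longrightarrow> uniform_in_valuation_ring M (c j)"
    and eps_def: "\<epsilon> = inverse (real (card (residue_field :: 'k set set)))"
begin

lemma eps: "0 < \<epsilon>" "\<epsilon> < 1"
proof -
  have "2 \<le> real (card (residue_field :: 'k set set))"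
    using residue_card_ge_2[where 'k='k] by simp
  then show "0 < \<epsilon>" "\<epsilon> < 1" unfolding eps_def by (auto simp: inverse_less_1_iff)
qed

lemma ball_measurable_c: "j \<in> J \<Longrightarrow> ball_measurable M (c j)"
  using uniform[of j] by (intro ball_measurable_compose) (simp add: uniform_in_valuation_ring_def)

lemma prob_c_ball:
  assumes "j \<in> J" "a \<in> ideal_power 0"
  shows "prob {\<omega>\<in>space M. c j \<omega> - a \<in> ideal_power m} = \<epsilon> ^ m"
proof -
  let ?R = "restrict_space borel (valuation_ring :: 'k set)"
  have cm: "c j \<in> measurable M ?R" and haar: "normalized_haar_measure (distr M ?R (c j))"
    using uniform[OF assms(1)] by (auto simp: uniform_in_valuation_ring_def)
  have "{x. x - a \<in> ideal_power m} \<in> sets ?R"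
    using ball_in_restrict_space[of a m] ball_subset_ideal_power_0[OF assms(2)] by (simp add: Int_absorb2)
  then have "measure (distr M ?R (c j)) {x. x - a \<in> ideal_power m} =
      prob (c j -` {x. x - a \<in> ideal_power m} \<inter> space M)"
    using cm by (intro measure_distr)
  also have "c j -` {x. x - a \<in> ideal_power m} \<inter> space M = {\<omega>\<in>space M. c j \<omega> - a \<in> ideal_power m}"
    by auto
  finally show ?thesis using measure_ball[OF haar assms(2)] by (simp add: eps_def)
qed

abbreviation others_space :: "nat \<Rightarrow> (nat \<Rightarrow> 'k) measure" where
  "others_space i \<equiv> PiM (J - {i}) (\<lambda>_. restrict_space borel valuation_ring)"

abbreviation others :: "nat \<Rightarrow> 'w \<Rightarrow> nat \<Rightarrow> 'k" where
  "others i \<omega> \<equiv> restrict (\<lambda>j. c j \<omega>) (J - {i})"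

lemma others_measurable: "others i \<in> measurable M (others_space i)"
  using uniform by (intro measurable_restrict) (auto simp: uniform_in_valuation_ring_def)

lemma ball_measurable_others:
  assumes "ball_measurable (others_space i) h"
  shows "ball_measurable M (\<lambda>\<omega>. h (others i \<omega>))"
  unfolding ball_measurable_def
proof (intro conjI ballI allI)
  show "h (others i \<omega>) \<in> ideal_power 0" if "\<omega> \<in> space M" for \<omega>
    using ball_measurableD(1)[OF assms] measurable_space[OF others_measurable that] by blast
  fix a m
  have "{\<omega>\<in>space M. h (others i \<omega>) - a \<in> ideal_power m} =
      others i -` {v \<in> space (others_space i). h v - a \<in> ideal_power m} \<inter> space M"
    using measurable_space[OF others_measurable, of _ i] by auto
  also have "\<dots> \<in> events"
    by (rule measurable_sets[OF others_measurable ball_measurableD(2)[OF assms]])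
  finally show "{\<omega>\<in>space M. h (others i \<omega>) - a \<in> ideal_power m} \<in> events" .
qed

lemma prob_independent_ball:
  assumes i: "i \<in> J" and A: "A \<in> sets (others_space i)" and a: "a \<in> ideal_power 0"
  shows "prob {\<omega>\<in>space M. others i \<omega> \<in> A \<and> c i \<omega> - a \<in> ideal_power m} =
    prob {\<omega>\<in>space M. others i \<omega> \<in> A} * \<epsilon> ^ m"
proof -
  let ?R = "\<lambda>_::nat. restrict_space borel (valuation_ring :: 'k set)"
  let ?X = "\<lambda>\<omega>. restrict (\<lambda>j. c j \<omega>) {i}"
  let ?B = "{v \<in> space (PiM {i} ?R). v i - a \<in> ideal_power m}"
  have ind: "indep_var (PiM {i} ?R) ?X (others_space i) (others i)"
    using indep i by (intro indep_var_restrict) auto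
  have X: "?X \<in> measurable M (PiM {i} ?R)"
    using uniform i by (intro measurable_restrict) (auto simp: uniform_in_valuation_ring_def)
  have "ball_measurable (PiM {i} ?R) (\<lambda>v. v i)"
    by (intro ball_measurable_compose) measurable
  then have B: "?B \<in> sets (PiM {i} ?R)" by (rule ball_measurableD)
  have "prob ((\<lambda>x. (?X x, others i x)) -` (?B \<times> A) \<inter> space M) =
      prob (?X -` ?B \<inter> space M) * prob (others i -` A \<inter> space M)"
    by (rule indep_varD[OF ind B A])
  also have "(\<lambda>x. (?X x, others i x)) -` (?B \<times> A) \<inter> space M =
      {\<omega>\<in>space M. others i \<omega> \<in> A \<and> c i \<omega> - a \<in> ideal_power m}"
    using measurable_space[OF X] by auto
  also have "?X -` ?B \<inter> space M = {\<omega>\<in>space M. c i \<omega> - a \<in> ideal_power m}"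
    using measurable_space[OF X] by auto
  also have "prob \<dots> = \<epsilon> ^ m" using i a by (rule prob_c_ball)
  also have "others i -` A \<inter> space M = {\<omega>\<in>space M. others i \<omega> \<in> A}" by auto
  finally show ?thesis by (simp only: mult.commute)
qed

text \<open>Given the other coefficients, \<open>c i\<close> plus any integral function \<open>h\<close> of them is still uniform.  One
  conditions on the residue \<open>s\<close> of \<open>h\<close>: adding \<open>s\<close> to \<open>c i\<close> only moves the centre of the ball, which
  does not affect its measure.\<close>

lemma prob_translated_ball:
  assumes i: "i \<in> J" and A: "A \<in> sets (others_space i)" and h: "ball_measurable (others_space i) h"
  shows "prob {\<omega>\<in>space M. others i \<omega> \<in> A \<and> c i \<omega> + h (others i \<omega>) \<in> ideal_power m} =
    prob {\<omega>\<in>space M. others i \<omega> \<in> A} * \<epsilon> ^ m"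
proof -
  let ?h = "\<lambda>\<omega>. h (others i \<omega>)"
  let ?A = "{\<omega>\<in>space M. others i \<omega> \<in> A}"
  let ?E = "{\<omega>\<in>space M. others i \<omega> \<in> A \<and> c i \<omega> + ?h \<omega> \<in> ideal_power m}"
  have hM: "ball_measurable M ?h" using h by (rule ball_measurable_others)
  have Aev: "?A \<in> events"
    using measurable_sets[OF others_measurable A] by (simp add: vimage_def Int_def conj_commute)
  have "?E = ?A \<inter> {\<omega>\<in>space M. c i \<omega> + ?h \<omega> \<in> ideal_power m}" by auto
  also have "\<dots> \<in> events"
    using Aev ball_measurableD(3)[OF ball_measurable_add[OF ball_measurable_c[OF i] hM]] by auto
  finally have Eev: "?E \<in> events" .
  have "prob ?E = (\<Sum>s\<in>expansions m. prob {\<omega>\<in>?E. ?h \<omega> - s \<in> ideal_power m})"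
    using Eev hM by (rule prob_partition)
  also have "\<dots> = (\<Sum>s\<in>expansions m. prob {\<omega>\<in>?A. ?h \<omega> - s \<in> ideal_power m} * \<epsilon> ^ m)"
  proof (rule sum.cong[OF refl])
    fix s :: 'k assume s: "s \<in> expansions m"
    then have s0: "- s \<in> ideal_power 0" using expansions_subset by auto
    let ?A' = "A \<inter> {v\<in>space (others_space i). h v - s \<in> ideal_power m}"
    have A': "?A' \<in> sets (others_space i)" using A ball_measurableD(2)[OF h] by blast
    have eq: "c i \<omega> + ?h \<omega> \<in> ideal_power m \<longleftrightarrow> c i \<omega> - (- s) \<in> ideal_power m"
      if "?h \<omega> - s \<in> ideal_power m" for \<omega>
      using that by (intro ideal_power_cong[of _ _ m]) auto
    have "{\<omega>\<in>?E. ?h \<omega> - s \<in> ideal_power m} =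
        {\<omega>\<in>space M. others i \<omega> \<in> ?A' \<and> c i \<omega> - (- s) \<in> ideal_power m}"
      using measurable_space[OF others_measurable, of _ i] eq by blast
    moreover have "{\<omega>\<in>?A. ?h \<omega> - s \<in> ideal_power m} = {\<omega>\<in>space M. others i \<omega> \<in> ?A'}"
      using measurable_space[OF others_measurable, of _ i] by blast
    ultimately show "prob {\<omega>\<in>?E. ?h \<omega> - s \<in> ideal_power m} = prob {\<omega>\<in>?A. ?h \<omega> - s \<in> ideal_power m} * \<epsilon> ^ m"
      using prob_independent_ball[OF i A' s0] by presburger
  qed
  also have "\<dots> = prob ?A * \<epsilon> ^ m"
    using prob_partition[OF Aev hM, of m] by (simp add: sum_distrib_right)
  finally show ?thesis .
qed

lemma ball_measurable_form:
  assumes "I \<subseteq> J" "\<And>j. j \<in> I \<Longrightarrow> e j \<in> ideal_power 0"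
  shows "ball_measurable M (\<lambda>\<omega>. \<Sum>j\<in>I. e j * c j \<omega>)"
proof (rule ball_measurable_linear_form)
  show "finite I" using assms(1) finite_J by (rule finite_subset)
  show "ball_measurable M (c j)" if "j \<in> I" for j
    using that assms(1) by (intro ball_measurable_c) blast
  show "e j \<in> ideal_power 0" if "j \<in> I" for j using that by (rule assms(2))
qed

lemma ball_measurable_others_form:
  assumes "\<And>j. j \<in> J - {i} \<Longrightarrow> e j \<in> ideal_power 0"
  shows "ball_measurable (others_space i) (\<lambda>v. \<Sum>j\<in>J - {i}. e j * v j)"
proof (rule ball_measurable_linear_form)
  fix j assume "j \<in> J - {i}"
  then show "ball_measurable (others_space i) (\<lambda>v. v j)"
    by (intro ball_measurable_compose measurable_component_singleton)
  show "e j \<in> ideal_power 0" using \<open>j \<in> J - {i}\<close> by (rule assms)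
qed (simp add: finite_J)

lemma prob_conditional_form:
  assumes i: "i \<in> J"
    and d: "\<And>j. j \<in> J - {i} \<Longrightarrow> d j \<in> ideal_power 0"
    and e: "\<And>j. j \<in> J - {i} \<Longrightarrow> e j \<in> ideal_power 0"
  shows "prob {\<omega>\<in>space M. (\<Sum>j\<in>J - {i}. d j * c j \<omega>) \<in> ideal_power k \<and>
      c i \<omega> + (\<Sum>j\<in>J - {i}. e j * c j \<omega>) \<in> ideal_power m} =
    prob {\<omega>\<in>space M. (\<Sum>j\<in>J - {i}. d j * c j \<omega>) \<in> ideal_power k} * \<epsilon> ^ m"
proof -
  let ?A = "{v \<in> space (others_space i). (\<Sum>j\<in>J - {i}. d j * v j) \<in> ideal_power k}"
  have form: "(\<Sum>j\<in>J - {i}. f j * others i \<omega> j) = (\<Sum>j\<in>J - {i}. f j * c j \<omega>)" for f \<omega>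
    by (intro sum.cong) auto
  have A: "?A \<in> sets (others_space i)"
    by (rule ball_measurableD(3)[OF ball_measurable_others_form[OF d]])
  have mem: "others i \<omega> \<in> ?A \<longleftrightarrow> (\<Sum>j\<in>J - {i}. d j * c j \<omega>) \<in> ideal_power k" if "\<omega> \<in> space M" for \<omega>
    using measurable_space[OF others_measurable that, of i] form[of d \<omega>] by simp
  have "{\<omega>\<in>space M. (\<Sum>j\<in>J - {i}. d j * c j \<omega>) \<in> ideal_power k} = {\<omega>\<in>space M. others i \<omega> \<in> ?A}"
    using mem by blast
  moreover have "{\<omega>\<in>space M. (\<Sum>j\<in>J - {i}. d j * c j \<omega>) \<in> ideal_power k \<and>
      c i \<omega> + (\<Sum>j\<in>J - {i}. e j * c j \<omega>) \<in> ideal_power m} =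
     {\<omega>\<in>space M. others i \<omega> \<in> ?A \<and> c i \<omega> + (\<Sum>j\<in>J - {i}. e j * others i \<omega> j) \<in> ideal_power m}"
    unfolding form using mem by blast
  ultimately show ?thesis
    using prob_translated_ball[OF i A ball_measurable_others_form[OF e]] by presburger
qed

lemma prob_affine_form:
  assumes i: "i \<in> J" and e: "\<And>j. j \<in> J - {i} \<Longrightarrow> e j \<in> ideal_power 0"
  shows "prob {\<omega>\<in>space M. c i \<omega> + (\<Sum>j\<in>J - {i}. e j * c j \<omega>) \<in> ideal_power m} = \<epsilon> ^ m"
  using prob_conditional_form[OF i _ e, where d = "\<lambda>_. 0" and k = 0 and m = m] by (simp add: prob_space)

text \<open>Dividing by a coefficient \<open>d i\<close> of maximal absolute value turns the form into \<open>c i\<close> plus an integral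
  form in the other variables, which is uniform; so the form is distributed like \<open>d i\<close> times a
  uniform variable.  For \<open>k \<le> u\<close> the truncated subtraction gives the probability one.\<close>

lemma prob_form:
  assumes i: "i \<in> J" and d: "\<And>j. j \<in> J \<Longrightarrow> d j \<in> ideal_power u" and di: "d i \<notin> ideal_power (Suc u)"
  shows "prob {\<omega>\<in>space M. (\<Sum>j\<in>J. d j * c j \<omega>) \<in> ideal_power k} = \<epsilon> ^ (k - u)"
proof (cases "k \<le> u")
  case True
  have "(\<Sum>j\<in>J. d j * c j \<omega>) \<in> ideal_power k" if \<omega>: "\<omega> \<in> space M" for \<omega>
  proof (rule ideal_power_sum)
    fix j assume j: "j \<in> J"
    have "c j \<omega> * d j \<in> ideal_power u"
      using j d ball_measurableD(1)[OF ball_measurable_c \<omega>] by (intro ideal_power_0_mult) auto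
    then show "d j * c j \<omega> \<in> ideal_power k"
      using ideal_power_antimono[OF True] by (auto simp: mult.commute)
  qed
  then have "{\<omega>\<in>space M. (\<Sum>j\<in>J. d j * c j \<omega>) \<in> ideal_power k} = space M" by blast
  then show ?thesis using True by (simp add: prob_space)
next
  case False
  then obtain m where m: "k = u + m" by (metis le_iff_add nat_le_linear)
  have abs: "absval (d i) = absval (uniformizer :: 'k) ^ u" using absval_level d[OF i] di by blast
  have di0: "d i \<noteq> 0" using di by auto
  have e: "d j / d i \<in> ideal_power 0" if "j \<in> J - {i}" for j
    using ideal_power_mult_cancel[OF abs, of "d j / d i" 0] d[of j] that di0 by simp
  have "(\<Sum>j\<in>J. d j * c j \<omega>) = d i * (c i \<omega> + (\<Sum>j\<in>J - {i}. d j / d i * c j \<omega>))" for \<omega>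
    using i finite_J di0 by (simp add: sum.remove[of J i] distrib_left sum_distrib_left)
  then have "(\<Sum>j\<in>J. d j * c j \<omega>) \<in> ideal_power k \<longleftrightarrow>
      c i \<omega> + (\<Sum>j\<in>J - {i}. d j / d i * c j \<omega>) \<in> ideal_power m" for \<omega>
    using ideal_power_mult_cancel[OF abs] m by simp
  then show ?thesis using prob_affine_form[OF i e, where m = m] m by simp
qed

end

section \<open>Probability of an approximate zero\<close>

text \<open>For a uniform variable \<open>U\<close> and an element \<open>d\<close> whose level is \<open>u\<close>, the difference \<open>\<epsilon> ^ (k - u) - \<epsilon> ^ (Suc k - u)\<close> is
  the probability that \<open>d U\<close> has level \<open>k\<close>, and \<open>\<epsilon> ^ k\<close> is its normalized absolute value.  The
  sum is thus the mean absolute value of \<open>d U\<close> truncated to levels below \<open>n\<close>; its limit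
  \<open>\<epsilon> ^ u / (1 + \<epsilon>)\<close> is the source of the constant in the theorem.\<close>

lemma sum_truncated_levels:
  fixes \<epsilon> :: real
  assumes "0 < \<epsilon>"
  shows "(\<Sum>k<n. (\<epsilon> ^ (k - u) - \<epsilon> ^ (Suc k - u)) * \<epsilon> ^ k) = \<epsilon> ^ u * (1 - \<epsilon> ^ (2 * (n - u))) / (1 + \<epsilon>)"
proof (induction n)
  case (Suc n)
  show ?case
  proof (cases "n < u")
    case True
    then show ?thesis using Suc by simp
  next
    case False
    then obtain m where m: "n = u + m" using le_Suc_ex[of u n] by auto
    have "(\<epsilon> ^ (n - u) - \<epsilon> ^ (Suc n - u)) * \<epsilon> ^ n = (\<epsilon> ^ m - \<epsilon> * \<epsilon> ^ m) * (\<epsilon> ^ u * \<epsilon> ^ m)"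
      by (simp add: m Suc_diff_le power_add)
    moreover have "\<epsilon> ^ (2 * (Suc n - u)) = \<epsilon>\<^sup>2 * (\<epsilon> ^ m)\<^sup>2"
      by (simp add: m Suc_diff_le power_add power2_eq_square power_mult power_mult_distrib)
    moreover have "\<epsilon> ^ (2 * (n - u)) = (\<epsilon> ^ m)\<^sup>2"
      by (simp add: m power_mult[symmetric] mult.commute)
    moreover have "\<epsilon> ^ u * (1 - E\<^sup>2) / (1 + \<epsilon>) + (E - \<epsilon> * E) * (\<epsilon> ^ u * E) = \<epsilon> ^ u * (1 - \<epsilon>\<^sup>2 * E\<^sup>2) / (1 + \<epsilon>)" for E
      using assms by (simp add: divide_simps) (simp add: algebra_simps power2_eq_square)
    ultimately show ?thesis using Suc by simp
  qed
qed simp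

text \<open>The level of the largest coefficient, which is the parameter \<open>u\<close> of \<open>prob_form\<close>.\<close>

lemma common_level_exists:
  fixes d :: "nat \<Rightarrow> 'k::nonarch_local_field_char_0"
  assumes "\<And>j. j \<in> I \<Longrightarrow> d j \<in> ideal_power u" "j0 \<in> I" "d j0 \<noteq> 0"
  shows "\<exists>v\<ge>u. (\<forall>j\<in>I. d j \<in> ideal_power v) \<and> (\<exists>j\<in>I. d j \<notin> ideal_power (Suc v))"
proof -
  define P where "P n \<longleftrightarrow> (\<forall>j\<in>I. d j \<in> ideal_power n)" for n
  obtain N where "\<not> P N" using assms(2,3) ideal_power_Inter[of "d j0"] unfolding P_def by blast
  define w where "w = (LEAST n. \<not> P n)"
  have w: "\<not> P w" using \<open>\<not> P N\<close> unfolding w_def by (rule LeastI)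
  have "u < w"
  proof (rule ccontr)
    assume "\<not> u < w"
    then have "P w" using assms(1) ideal_power_antimono[of w u] unfolding P_def by auto
    then show False using w by simp
  qed
  then obtain v where v: "w = Suc v" "u \<le> v" by (cases w) auto
  have "P v" using not_less_Least[of v "\<lambda>n. \<not> P n"] v unfolding w_def[symmetric] by simp
  then show ?thesis using v w unfolding P_def by blast
qed

context uniform_coefficients
begin

text \<open>The event that a point is an approximate zero modulo the \<open>n\<close>-th power, for the polynomial whose value there is
  \<open>c i\<close> plus the form with coefficients \<open>e\<close> and whose derivative is the form with coefficients \<open>d\<close>.\<close>

definition near_zero_event :: "nat \<Rightarrow> (nat \<Rightarrow> 'k) \<Rightarrow> (nat \<Rightarrow> 'k) \<Rightarrow> nat \<Rightarrow> 'w set" where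
  "near_zero_event i d e n = {\<omega>\<in>space M. \<exists>k<n.
     (\<Sum>j\<in>J - {i}. d j * c j \<omega>) \<in> ideal_power k \<and> (\<Sum>j\<in>J - {i}. d j * c j \<omega>) \<notin> ideal_power (Suc k) \<and>
     c i \<omega> + (\<Sum>j\<in>J - {i}. e j * c j \<omega>) \<in> ideal_power (k + n)}"

lemma affine_form_event:
  assumes i: "i \<in> J" and e: "\<And>j. j \<in> J - {i} \<Longrightarrow> e j \<in> ideal_power 0"
  shows "{\<omega>\<in>space M. c i \<omega> + (\<Sum>j\<in>J - {i}. e j * c j \<omega>) \<in> ideal_power m} \<in> events"
proof -
  have "ball_measurable M (\<lambda>\<omega>. \<Sum>j\<in>J - {i}. e j * c j \<omega>)"
    using e by (intro ball_measurable_form) auto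
  then show ?thesis
    using ball_measurable_add[OF ball_measurable_c[OF i]] by (intro ball_measurableD(3))
qed

lemma form_event:
  assumes d: "\<And>j. j \<in> J - {i} \<Longrightarrow> d j \<in> ideal_power 0"
  shows "{\<omega>\<in>space M. (\<Sum>j\<in>J - {i}. d j * c j \<omega>) \<in> ideal_power m} \<in> events"
  by (rule ball_measurableD(3)[OF ball_measurable_form[where e = d, OF Diff_subset d]])

text \<open>The event splits according to the level \<open>k\<close> of the derivative.  The derivative does not involve \<open>c i\<close>, so
  given it the value is uniform, and it is of level \<open>k + n\<close> with probability \<open>\<epsilon> ^ (k + n)\<close>.\<close>

lemma
  assumes i: "i \<in> J"
    and d: "\<And>j. j \<in> J - {i} \<Longrightarrow> d j \<in> ideal_power 0"
    and e: "\<And>j. j \<in> J - {i} \<Longrightarrow> e j \<in> ideal_power 0"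
  shows near_zero_event: "near_zero_event i d e n \<in> events"
    and prob_near_zero_event: "prob (near_zero_event i d e n) = (\<Sum>k<n.
      (prob {\<omega>\<in>space M. (\<Sum>j\<in>J - {i}. d j * c j \<omega>) \<in> ideal_power k} -
       prob {\<omega>\<in>space M. (\<Sum>j\<in>J - {i}. d j * c j \<omega>) \<in> ideal_power (Suc k)}) * \<epsilon> ^ (k + n))"
proof -
  define D where "D \<omega> = (\<Sum>j\<in>J - {i}. d j * c j \<omega>)" for \<omega>
  define E where "E \<omega> = c i \<omega> + (\<Sum>j\<in>J - {i}. e j * c j \<omega>)" for \<omega>
  define U where "U k m = {\<omega>\<in>space M. D \<omega> \<in> ideal_power k \<and> E \<omega> \<in> ideal_power m}" for k m
  have evD: "{\<omega>\<in>space M. D \<omega> \<in> ideal_power k} \<in> events" for k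
    unfolding D_def by (rule form_event[OF d])
  have evE: "{\<omega>\<in>space M. E \<omega> \<in> ideal_power k} \<in> events" for k
    unfolding E_def by (rule affine_form_event[OF i e])
  have evU: "U k m \<in> events" for k m
    unfolding U_def by (intro sets.sets_Collect_conj evD evE)
  have sub: "U (Suc k) m \<subseteq> U k m" for k m
    using ideal_power_antimono[of k "Suc k", where 'k='k] by (auto simp: U_def)
  have probU: "prob (U k m) = prob {\<omega>\<in>space M. D \<omega> \<in> ideal_power k} * \<epsilon> ^ m" for k m
    unfolding U_def D_def E_def by (rule prob_conditional_form[OF i d e])
  have eq: "near_zero_event i d e n = (\<Union>k<n. U k (k + n) - U (Suc k) (k + n))"
    by (auto simp: near_zero_event_def U_def D_def E_def)
  show "near_zero_event i d e n \<in> events" unfolding eq using evU by auto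
  have disj: "disjoint_family_on (\<lambda>k. U k (k + n) - U (Suc k) (k + n)) {..<n}"
    unfolding disjoint_family_on_def
  proof (intro ballI impI)
    have *: "(U k (k + n) - U (Suc k) (k + n)) \<inter> (U k' (k' + n) - U (Suc k') (k' + n)) = {}" if "k < k'" for k k'
    proof -
      have "ideal_power k' \<subseteq> (ideal_power (Suc k) :: 'k set)"
        using that by (intro ideal_power_antimono) auto
      then show ?thesis by (auto simp: U_def)
    qed
    fix k k' :: nat assume "k \<noteq> k'"
    then show "(U k (k + n) - U (Suc k) (k + n)) \<inter> (U k' (k' + n) - U (Suc k') (k' + n)) = {}"
      using *[of k k'] *[of k' k] by (cases "k < k'") auto
  qed
  have "prob (near_zero_event i d e n) = (\<Sum>k<n. prob (U k (k + n) - U (Suc k) (k + n)))"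
    unfolding eq using disj evU by (intro finite_measure_finite_Union) auto
  also have "\<dots> = (\<Sum>k<n. prob (U k (k + n)) - prob (U (Suc k) (k + n)))"
    using evU sub by (intro sum.cong refl finite_measure_Diff)
  finally show "prob (near_zero_event i d e n) = (\<Sum>k<n.
      (prob {\<omega>\<in>space M. (\<Sum>j\<in>J - {i}. d j * c j \<omega>) \<in> ideal_power k} -
       prob {\<omega>\<in>space M. (\<Sum>j\<in>J - {i}. d j * c j \<omega>) \<in> ideal_power (Suc k)}) * \<epsilon> ^ (k + n))"
    unfolding probU D_def by (simp add: left_diff_distrib)
qed

lemma prob_near_zero_event_eq:
  assumes i: "i \<in> J"
    and d: "\<And>j. j \<in> J - {i} \<Longrightarrow> d j \<in> ideal_power u"
    and d': "j0 \<in> J - {i}" "d j0 \<notin> ideal_power (Suc u)"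
    and e: "\<And>j. j \<in> J - {i} \<Longrightarrow> e j \<in> ideal_power 0"
  shows "prob (near_zero_event i d e n) = \<epsilon> ^ (n + u) * (1 - \<epsilon> ^ (2 * (n - u))) / (1 + \<epsilon>)"
proof -
  interpret rest: uniform_coefficients M c "J - {i}" \<epsilon>
    using finite_J indep_vars_subset[OF indep, of "J - {i}"] uniform eps_def
    by unfold_locales auto
  have d0: "d j \<in> ideal_power 0" if "j \<in> J - {i}" for j
    using d[OF that] ideal_power_antimono[of 0 u] by auto
  have "prob {\<omega>\<in>space M. (\<Sum>j\<in>J - {i}. d j * c j \<omega>) \<in> ideal_power k} = \<epsilon> ^ (k - u)" for k
    by (rule rest.prob_form[where d = d and u = u, OF d'(1) d d'(2)])
  then have "prob (near_zero_event i d e n) = (\<Sum>k<n. (\<epsilon> ^ (k - u) - \<epsilon> ^ (Suc k - u)) * \<epsilon> ^ (k + n))"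
    using prob_near_zero_event[where d = d and e = e and n = n, OF i d0 e] by simp
  also have "\<dots> = \<epsilon> ^ n * (\<Sum>k<n. (\<epsilon> ^ (k - u) - \<epsilon> ^ (Suc k - u)) * \<epsilon> ^ k)"
    by (simp add: sum_distrib_left power_add mult_ac)
  also have "\<dots> = \<epsilon> ^ (n + u) * (1 - \<epsilon> ^ (2 * (n - u))) / (1 + \<epsilon>)"
    unfolding sum_truncated_levels[OF eps(1)] by (simp add: power_add)
  finally show ?thesis .
qed

lemma prob_near_zero_event_le:
  assumes i: "i \<in> J"
    and d: "\<And>j. j \<in> J - {i} \<Longrightarrow> d j \<in> ideal_power u"
    and e: "\<And>j. j \<in> J - {i} \<Longrightarrow> e j \<in> ideal_power 0"
  shows "prob (near_zero_event i d e n) \<le> \<epsilon> ^ (n + u) / (1 + \<epsilon>)"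
proof (cases "\<forall>j\<in>J - {i}. d j = 0")
  case True
  then have "near_zero_event i d e n = {}" by (auto simp: near_zero_event_def)
  then show ?thesis using eps by simp
next
  case False
  then obtain j0 where "j0 \<in> J - {i}" "d j0 \<noteq> 0" by blast
  then obtain v j where v: "u \<le> v" "\<And>j. j \<in> J - {i} \<Longrightarrow> d j \<in> ideal_power v"
      "j \<in> J - {i}" "d j \<notin> ideal_power (Suc v)"
    using common_level_exists[of "J - {i}" d u j0] d by blast
  have "prob (near_zero_event i d e n) = \<epsilon> ^ (n + v) * (1 - \<epsilon> ^ (2 * (n - v))) / (1 + \<epsilon>)"
    by (rule prob_near_zero_event_eq[where d = d and u = v, OF i v(2-4) e])
  also have "\<dots> \<le> \<epsilon> ^ (n + u) * 1 / (1 + \<epsilon>)"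
    using eps v(1) by (intro divide_right_mono mult_mono power_decreasing) (auto simp: power_le_one)
  finally show ?thesis by simp
qed

lemma AE_notin_of_prob_le_power:
  assumes "\<And>n. A n \<in> events" "\<And>n. prob (A n) \<le> \<epsilon> ^ n" "\<And>n \<omega>. \<omega> \<in> space M \<Longrightarrow> P \<omega> \<Longrightarrow> \<omega> \<in> A n"
  shows "AE \<omega> in M. \<not> P \<omega>"
proof (rule AE_I)
  show ev: "(\<Inter>n. A n) \<in> events" using assms(1) by auto
  show "{\<omega>\<in>space M. \<not> \<not> P \<omega>} \<subseteq> (\<Inter>n. A n)" using assms(3) by auto
  have "prob (\<Inter>n. A n) \<le> \<epsilon> ^ n" for n
    using finite_measure_mono[of "\<Inter>n. A n" "A n"] assms(1,2)[of n] by force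
  then have "prob (\<Inter>n. A n) \<le> 0"
    using LIMSEQ_realpow_zero[of \<epsilon>] eps by (intro LIMSEQ_le_const) auto
  then show "emeasure M (\<Inter>n. A n) = 0" by (simp add: emeasure_eq_measure measure_le_0_iff)
qed

end

section \<open>Zeros of a random polynomial in a ball\<close>

text \<open>Polynomials whose constant term, with index \<open>i\<close>, is one of the random coefficients.\<close>

locale random_polynomial = uniform_coefficients M c J \<epsilon>
  for M :: "'w measure" and c :: "nat \<Rightarrow> 'w \<Rightarrow> 'k::nonarch_local_field_char_0" and J \<epsilon> +
  fixes b :: "nat \<Rightarrow> nat" and i :: nat
  assumes i: "i \<in> J" and b_i: "b i = 0" and b_pos: "j \<in> J - {i} \<Longrightarrow> 1 \<le> b j"
begin

definition F :: "'w \<Rightarrow> 'k \<Rightarrow> 'k" where "F \<omega> = poly_sum J b (\<lambda>j. c j \<omega>)"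

definition F' :: "'w \<Rightarrow> 'k \<Rightarrow> 'k" where "F' \<omega> = poly_sum_deriv J b (\<lambda>j. c j \<omega>)"

lemma F_eq: "F \<omega> x = c i \<omega> + (\<Sum>j\<in>J - {i}. x ^ b j * c j \<omega>)"
  unfolding F_def poly_sum_def using i finite_J by (subst sum.remove[of J i]) (auto simp: b_i)

lemma F'_eq: "F' \<omega> x = (\<Sum>j\<in>J - {i}. (of_nat (b j) * x ^ (b j - 1)) * c j \<omega>)"
  unfolding F'_def poly_sum_deriv_def using i finite_J by (subst sum.remove[of J i]) (auto simp: b_i)

lemma taylor_pair_F:
  assumes "\<omega> \<in> space M" shows "taylor_pair (F \<omega>) (F' \<omega>)"
  unfolding F_def F'_def
  using finite_J
proof (rule taylor_pair_poly_sum)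
  show "c j \<omega> \<in> ideal_power 0" if "j \<in> J" for j
    by (rule ball_measurableD(1)[OF ball_measurable_c[OF that] assms])
qed

lemma prob_F_small:
  assumes "x \<in> ideal_power 0"
  shows "{\<omega>\<in>space M. F \<omega> x \<in> ideal_power m} \<in> events"
    "prob {\<omega>\<in>space M. F \<omega> x \<in> ideal_power m} = \<epsilon> ^ m"
  unfolding F_eq
  by (rule affine_form_event[where e = "\<lambda>j. x ^ b j", OF i ideal_power_0_power[OF assms]])
    (rule prob_affine_form[where e = "\<lambda>j. x ^ b j", OF i ideal_power_0_power[OF assms]])

lemma card_expansions_eps:
  assumes "l \<le> n"
  shows "real (card (expansions n \<inter> (ideal_power l :: 'k set))) * \<epsilon> ^ n = \<epsilon> ^ l"
proof -
  obtain m where m: "n = l + m" using assms le_Suc_ex by blast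
  define q where "q = real (card (residue_field :: 'k set set))"
  have "q \<noteq> 0" using residue_card_ge_2[where 'k='k] by (auto simp: q_def)
  moreover have "\<epsilon> = inverse q" by (simp add: eps_def q_def)
  ultimately have "q ^ m * \<epsilon> ^ m = 1" by (simp flip: power_mult_distrib)
  moreover have "real (card (expansions n \<inter> (ideal_power l :: 'k set))) = q ^ m"
    using card_expansions_in_ideal_power[OF assms, where 'k='k] by (simp add: q_def m)
  ultimately show ?thesis by (simp add: m power_add)
qed

text \<open>A double zero forces \<open>F\<close> to be of level \<open>2 n\<close> at one of the \<open>\<epsilon> ^ (- n)\<close> representatives modulo the
  \<open>n\<close>-th power.  At each of them this has probability \<open>\<epsilon> ^ (2 n)\<close>, so the total is at most \<open>\<epsilon> ^ n\<close>.\<close>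

lemma AE_simple_zeros:
  "AE \<omega> in M. \<not> (\<exists>z\<in>ideal_power 0. F \<omega> z = 0 \<and> F' \<omega> z = 0)"
proof (rule AE_notin_of_prob_le_power)
  let ?A = "\<lambda>n s. {\<omega>\<in>space M. F \<omega> s \<in> ideal_power (n + n)}"
  fix n
  have s: "s \<in> expansions n \<Longrightarrow> s \<in> ideal_power 0" for s :: 'k using expansions_subset by auto
  show "(\<Union>s\<in>expansions n. ?A n s) \<in> events"
    using prob_F_small(1)[OF s] by (intro sets.finite_UN) auto
  have "prob (\<Union>s\<in>expansions n. ?A n s) \<le> (\<Sum>s\<in>expansions n. prob (?A n s))"
    using prob_F_small(1)[OF s] by (intro measure_UNION_le) auto
  also have "\<dots> = real (card (expansions n :: 'k set)) * \<epsilon> ^ (n + n)"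
    using prob_F_small(2)[OF s] by simp
  also have "\<dots> = \<epsilon> ^ n"
    using card_expansions_eps[of 0 n] expansions_subset[of n, where 'k='k] by (simp add: Int_absorb2 power_add)
  finally show "prob (\<Union>s\<in>expansions n. ?A n s) \<le> \<epsilon> ^ n" .
  fix \<omega> assume "\<omega> \<in> space M" "\<exists>z\<in>ideal_power 0. F \<omega> z = 0 \<and> F' \<omega> z = 0"
  then show "\<omega> \<in> (\<Union>s\<in>expansions n. ?A n s)"
    using double_zero_approx[OF taylor_pair_F, of \<omega> _ n] by blast
qed

lemma AE_F_0_nonzero: "AE \<omega> in M. \<not> F \<omega> 0 = 0"
  by (rule AE_notin_of_prob_le_power[where A = "\<lambda>n. {\<omega>\<in>space M. F \<omega> 0 \<in> ideal_power n}"])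
    (auto simp: prob_F_small)

definition zero_count :: "nat \<Rightarrow> 'w \<Rightarrow> nat \<Rightarrow> ennreal" where
  "zero_count l \<omega> n = of_nat (card (approx_zeros (F \<omega>) (F' \<omega>) l (n + Suc l)))"

text \<open>The point \<open>0\<close> may be removed from the ball, since it is a zero only if the constant term vanishes,
  an event of probability zero.\<close>

lemma AE_num_zeros_eq_SUP:
  "AE \<omega> in M. num_zeros (F \<omega>) (ideal_power l - {0}) = (SUP n. zero_count l \<omega> n)"
  using AE_simple_zeros AE_F_0_nonzero AE_space
proof eventually_elim
  case (elim \<omega>)
  have "{z \<in> ideal_power l - {0}. F \<omega> z = 0} = {z \<in> ideal_power l. F \<omega> z = 0}"
    using elim by auto
  then have "num_zeros (F \<omega>) (ideal_power l - {0}) = num_zeros (F \<omega>) (ideal_power l)"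
    by (simp add: num_zeros_def)
  also have "\<dots> = (SUP n. zero_count l \<omega> n)"
    unfolding zero_count_def
  proof (rule num_simple_zeros_eq_SUP)
    show "taylor_pair (F \<omega>) (F' \<omega>)" using elim by (intro taylor_pair_F)
    show "F' \<omega> z \<noteq> 0" if "z \<in> ideal_power l" "F \<omega> z = 0" for z
      using that elim ideal_power_antimono[of 0 l] by auto
  qed
  finally show ?case .
qed

abbreviation near_zero :: "'k \<Rightarrow> nat \<Rightarrow> 'w set" where
  "near_zero x n \<equiv> near_zero_event i (\<lambda>j. of_nat (b j) * x ^ (b j - 1)) (\<lambda>j. x ^ b j) n"

lemma coeffs_integral:
  assumes "x \<in> ideal_power 0"
  shows "of_nat (b j) * x ^ (b j - 1) \<in> ideal_power 0" "x ^ b j \<in> ideal_power 0"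
proof -
  show "x ^ b j \<in> ideal_power 0" using assms by (rule ideal_power_0_power)
  show "of_nat (b j) * x ^ (b j - 1) \<in> ideal_power 0"
    by (rule ideal_power_0_mult[OF ideal_power_0_of_nat ideal_power_0_power[OF assms]])
qed

lemma zero_count_eq:
  assumes "\<omega> \<in> space M"
  shows "zero_count l \<omega> n =
    (\<Sum>x\<in>expansions (n + Suc l) \<inter> ideal_power l. indicator (near_zero x (n + Suc l)) \<omega>)"
proof -
  let ?A = "expansions (n + Suc l) \<inter> ideal_power l :: 'k set"
  have eq: "approx_zeros (F \<omega>) (F' \<omega>) l (n + Suc l) = {x\<in>?A. \<omega> \<in> near_zero x (n + Suc l)}"
    using assms unfolding approx_zeros_def near_zero_event_def F_eq F'_eq by auto
  have "(\<Sum>x\<in>?A. indicator (near_zero x (n + Suc l)) \<omega>) =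
      (of_nat (card {x\<in>?A. \<omega> \<in> near_zero x (n + Suc l)}) :: ennreal)"
    unfolding indicator_def of_bool_def by (simp add: sum.If_cases Int_def)
  then show ?thesis unfolding zero_count_def eq by (rule sym)
qed

definition mean_count :: "nat \<Rightarrow> nat \<Rightarrow> real" where
  "mean_count l n = (\<Sum>x\<in>expansions n \<inter> ideal_power l. prob (near_zero x n))"

lemma near_zero_events:
  assumes "x \<in> expansions n" shows "near_zero x m \<in> events"
proof -
  have x: "x \<in> ideal_power 0" using assms expansions_subset by blast
  show ?thesis by (rule near_zero_event[OF i coeffs_integral[OF x]])
qed

lemma measurable_zero_count: "(\<lambda>\<omega>. zero_count l \<omega> n) \<in> borel_measurable M"
proof -
  have "(\<lambda>\<omega>. \<Sum>x\<in>expansions (n + Suc l) \<inter> ideal_power l. indicator (near_zero x (n + Suc l)) \<omega> :: ennreal)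
      \<in> borel_measurable M"
    by (intro borel_measurable_sum borel_measurable_indicator near_zero_events) blast
  also have "?this \<longleftrightarrow> ?thesis"
    by (intro measurable_cong zero_count_eq[symmetric])
  finally show ?thesis .
qed

lemma nn_integral_zero_count: "(\<integral>\<^sup>+ \<omega>. zero_count l \<omega> n \<partial>M) = ennreal (mean_count l (n + Suc l))"
proof -
  let ?A = "expansions (n + Suc l) \<inter> ideal_power l :: 'k set"
  have "(\<integral>\<^sup>+ \<omega>. zero_count l \<omega> n \<partial>M) = (\<integral>\<^sup>+ \<omega>. (\<Sum>x\<in>?A. indicator (near_zero x (n + Suc l)) \<omega>) \<partial>M)"
    by (intro nn_integral_cong zero_count_eq)
  also have "\<dots> = (\<Sum>x\<in>?A. emeasure M (near_zero x (n + Suc l)))"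
    using near_zero_events by (subst nn_integral_sum) (auto intro!: sum.cong nn_integral_indicator)
  also have "\<dots> = ennreal (mean_count l (n + Suc l))"
    by (simp add: mean_count_def emeasure_eq_measure sum_ennreal)
  finally show ?thesis .
qed

lemma incseq_zero_count:
  assumes "\<omega> \<in> space M" shows "incseq (zero_count l \<omega>)"
proof -
  have "zero_count l \<omega> = (\<lambda>n. of_nat (card (approx_zeros (F \<omega>) (F' \<omega>) l (n + Suc l))))"
    by (rule ext) (rule zero_count_def)
  then show ?thesis using incseq_card_approx_zeros[OF taylor_pair_F[OF assms], of l] by argo
qed

lemma nn_integral_SUP_zero_count:
  "(\<integral>\<^sup>+ \<omega>. (SUP n. zero_count l \<omega> n) \<partial>M) = (SUP n. ennreal (mean_count l (n + Suc l)))"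
proof -
  have "(\<integral>\<^sup>+ \<omega>. (SUP n. zero_count l \<omega> n) \<partial>M) = (SUP n. \<integral>\<^sup>+ \<omega>. zero_count l \<omega> n \<partial>M)"
  proof (rule nn_integral_monotone_convergence_SUP_AE)
    show "AE \<omega> in M. zero_count l \<omega> n \<le> zero_count l \<omega> (Suc n)" for n
      by (rule AE_I2) (rule incseq_SucD[OF incseq_zero_count])
  qed (rule measurable_zero_count)
  then show ?thesis by (simp add: nn_integral_zero_count)
qed

lemma incseq_mean_count: "incseq (\<lambda>n. ennreal (mean_count l (n + Suc l)))"
proof (rule incseq_SucI)
  fix n
  have "(\<integral>\<^sup>+ \<omega>. zero_count l \<omega> n \<partial>M) \<le> (\<integral>\<^sup>+ \<omega>. zero_count l \<omega> (Suc n) \<partial>M)"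
    by (rule nn_integral_mono) (rule incseq_SucD[OF incseq_zero_count])
  then show "ennreal (mean_count l (n + Suc l)) \<le> ennreal (mean_count l (Suc n + Suc l))"
    unfolding nn_integral_zero_count .
qed

text \<open>The derivative now has the coefficient \<open>1\<close> at every point, so every representative has
  the same probability of being an approximate zero.\<close>

lemma SUP_mean_count_exponent_1:
  assumes j: "j \<in> J" "b j = 1"
  shows "(SUP n. ennreal (mean_count l (n + Suc l))) = ennreal (\<epsilon> ^ l / (1 + \<epsilon>))"
proof -
  have ji: "j \<in> J - {i}" using j b_i by auto
  have prob: "prob (near_zero x n) = \<epsilon> ^ n * ((1 - (\<epsilon>\<^sup>2) ^ n) / (1 + \<epsilon>))" if x: "x \<in> ideal_power 0" for x n
    using prob_near_zero_event_eq[where d = "\<lambda>j. of_nat (b j) * x ^ (b j - 1)" and e = "\<lambda>j. x ^ b j" and n = n,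
        OF i coeffs_integral(1)[OF x] ji _ coeffs_integral(2)[OF x]] j
    by (simp add: ideal_power_1 maximal_ideal_def power_mult)
  have "mean_count l n = \<epsilon> ^ l * ((1 - (\<epsilon>\<^sup>2) ^ n) / (1 + \<epsilon>))" if "l \<le> n" for n
  proof -
    have "mean_count l n = real (card (expansions n \<inter> (ideal_power l :: 'k set))) * (\<epsilon> ^ n * ((1 - (\<epsilon>\<^sup>2) ^ n) / (1 + \<epsilon>)))"
      unfolding mean_count_def using prob expansions_subset[of n, where 'k='k] by (subst sum.cong[OF refl prob]) auto
    then show ?thesis using card_expansions_eps[OF that] by (simp flip: mult.assoc)
  qed
  then have *: "mean_count l (n + Suc l) = \<epsilon> ^ l * ((1 - (\<epsilon>\<^sup>2) ^ (n + Suc l)) / (1 + \<epsilon>))" for n by simp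
  have "(\<lambda>n. (\<epsilon>\<^sup>2) ^ (n + Suc l)) \<longlonglongrightarrow> 0"
    using eps by (intro LIMSEQ_ignore_initial_segment LIMSEQ_realpow_zero) (auto simp: power_less_one_iff)
  then have "(\<lambda>n. mean_count l (n + Suc l)) \<longlonglongrightarrow> \<epsilon> ^ l * ((1 - 0) / (1 + \<epsilon>))"
    unfolding * using eps by (intro tendsto_intros) auto
  then have "(\<lambda>n. ennreal (mean_count l (n + Suc l))) \<longlonglongrightarrow> ennreal (\<epsilon> ^ l / (1 + \<epsilon>))"
    by (intro tendsto_ennrealI) simp
  then show ?thesis using LIMSEQ_SUP[OF incseq_mean_count] LIMSEQ_unique by blast
qed

text \<open>All monomials of the derivative now contain \<open>x\<close>, so on the smaller ball of radius \<open>Suc l\<close> the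
  probabilities lose a factor \<open>\<epsilon>\<close>.  The resulting bound is independent of \<open>n\<close> and strictly below
  \<open>\<epsilon> ^ l / (1 + \<epsilon>)\<close>.\<close>

lemma mean_count_exponents_ge_2:
  assumes b2: "\<And>j. j \<in> J - {i} \<Longrightarrow> 2 \<le> b j" and n: "Suc l \<le> n"
  shows "mean_count l n \<le> (\<epsilon> ^ l - \<epsilon> ^ Suc l * (1 - \<epsilon>)) / (1 + \<epsilon>)"
proof -
  let ?A = "expansions n \<inter> ideal_power l :: 'k set"
  let ?B = "expansions n \<inter> ideal_power (Suc l) :: 'k set"
  have BA: "?B \<subseteq> ?A" using ideal_power_antimono[of l "Suc l"] by auto
  have x0: "x \<in> ideal_power 0" if "x \<in> ?A" for x using that expansions_subset by auto
  have A: "prob (near_zero x n) \<le> \<epsilon> ^ n / (1 + \<epsilon>)" if "x \<in> ?A - ?B" for x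
    using prob_near_zero_event_le[where d = "\<lambda>j. of_nat (b j) * x ^ (b j - 1)" and e = "\<lambda>j. x ^ b j" and n = n,
        OF i coeffs_integral(1) coeffs_integral(2)] x0[of x] that by auto
  have B: "prob (near_zero x n) \<le> \<epsilon> ^ Suc n / (1 + \<epsilon>)" if x: "x \<in> ?B" for x
  proof -
    have x1: "x \<in> ideal_power (Suc 0)" using x ideal_power_antimono[of "Suc 0" "Suc l"] by auto
    have d: "of_nat (b j) * x ^ (b j - 1) \<in> ideal_power (Suc 0)" if j: "j \<in> J - {i}" for j
    proof -
      obtain m where m: "b j - 1 = Suc m" using b2[OF j] by (cases "b j - 1") auto
      have "(of_nat (b j) * x ^ m) * x \<in> ideal_power (Suc 0)"
        using x0[of x] x BA x1 by (intro ideal_power_0_mult ideal_power_0_power) auto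
      then show ?thesis unfolding m by (simp add: mult_ac)
    qed
    have "x \<in> ideal_power 0" using x0 x BA by blast
    then have "x ^ b j \<in> ideal_power 0" for j by (rule ideal_power_0_power)
    then have "prob (near_zero x n) \<le> \<epsilon> ^ (n + Suc 0) / (1 + \<epsilon>)"
      by (intro prob_near_zero_event_le[where d = "\<lambda>j. of_nat (b j) * x ^ (b j - 1)"
            and e = "\<lambda>j. x ^ b j", OF i d])
    then show ?thesis by (simp only: add_Suc_right add_0_right)
  qed
  have "mean_count l n = (\<Sum>x\<in>?A - ?B. prob (near_zero x n)) + (\<Sum>x\<in>?B. prob (near_zero x n))"
    unfolding mean_count_def using BA by (intro sum.subset_diff) auto
  also have "\<dots> \<le> (\<Sum>x\<in>?A - ?B. \<epsilon> ^ n / (1 + \<epsilon>)) + (\<Sum>x\<in>?B. \<epsilon> ^ Suc n / (1 + \<epsilon>))"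
    using A B by (intro add_mono sum_mono) auto
  also have "\<dots> = (real (card ?A) * \<epsilon> ^ n - real (card ?B) * \<epsilon> ^ n * (1 - \<epsilon>)) / (1 + \<epsilon>)"
    using BA eps card_mono[OF _ BA] by (simp add: card_Diff_subset of_nat_diff divide_simps) (simp add: algebra_simps)
  also have "\<dots> = (\<epsilon> ^ l - \<epsilon> ^ Suc l * (1 - \<epsilon>)) / (1 + \<epsilon>)"
    using card_expansions_eps[OF n] card_expansions_eps[of l n] n by simp
  finally show ?thesis .
qed

text \<open>Off the null set of double zeros and of a vanishing constant term, the number of zeros agrees with a
  limit of counts that are visibly measurable.  The measurable version \<open>\<Phi>\<close> allows expectations of several counts to be added.\<close>

lemma expected_zeros_in_ball:
  "\<exists>\<Phi>\<in>borel_measurable M. (AE \<omega> in M. num_zeros (F \<omega>) (ideal_power l - {0}) = \<Phi> \<omega>) \<and>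
     (\<exists>e\<ge>0. integral\<^sup>N M \<Phi> = ennreal e \<and> e \<le> \<epsilon> ^ l / (1 + \<epsilon>) \<and>
       (e = \<epsilon> ^ l / (1 + \<epsilon>) \<longleftrightarrow> (\<exists>j\<in>J. b j = 1)))"
proof (intro bexI conjI)
  show "AE \<omega> in M. num_zeros (F \<omega>) (ideal_power l - {0}) = (SUP n. zero_count l \<omega> n)"
    by (rule AE_num_zeros_eq_SUP)
  show "(\<lambda>\<omega>. SUP n. zero_count l \<omega> n) \<in> borel_measurable M"
    using measurable_zero_count by (intro borel_measurable_SUP) auto
  show "\<exists>e\<ge>0. (\<integral>\<^sup>+ \<omega>. (SUP n. zero_count l \<omega> n) \<partial>M) = ennreal e \<and> e \<le> \<epsilon> ^ l / (1 + \<epsilon>) \<and>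
       (e = \<epsilon> ^ l / (1 + \<epsilon>) \<longleftrightarrow> (\<exists>j\<in>J. b j = 1))"
  proof (cases "\<exists>j\<in>J. b j = 1")
    case True
    then have "(\<integral>\<^sup>+ \<omega>. (SUP n. zero_count l \<omega> n) \<partial>M) = ennreal (\<epsilon> ^ l / (1 + \<epsilon>))"
      using SUP_mean_count_exponent_1 unfolding nn_integral_SUP_zero_count by blast
    moreover have "0 \<le> \<epsilon> ^ l / (1 + \<epsilon>)" using eps by simp
    ultimately show ?thesis using True by blast
  next
    case False
    let ?B = "(\<epsilon> ^ l - \<epsilon> ^ Suc l * (1 - \<epsilon>)) / (1 + \<epsilon>)"
    let ?I = "\<integral>\<^sup>+ \<omega>. (SUP n. zero_count l \<omega> n) \<partial>M"
    have b2: "2 \<le> b j" if "j \<in> J - {i}" for j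
    proof -
      have "b j \<noteq> 1" using False that by blast
      then show ?thesis using b_pos[OF that] by simp
    qed
    have "?I \<le> ennreal ?B"
      unfolding nn_integral_SUP_zero_count using mean_count_exponents_ge_2[OF b2]
      by (intro SUP_least ennreal_leI) simp
    moreover have less: "?B < \<epsilon> ^ l / (1 + \<epsilon>)"
      using eps by (simp add: divide_strict_right_mono)
    moreover have "0 \<le> ?B"
    proof -
      have "\<epsilon> ^ Suc l * (1 - \<epsilon>) \<le> \<epsilon> ^ l * 1" using eps by (intro mult_mono power_decreasing) auto
      then show ?thesis using eps by simp
    qed
    ultimately obtain e where "0 \<le> e" "?I = ennreal e" "e \<le> ?B"
      by (cases ?I) (auto simp: top_unique)
    then show ?thesis using False less by (intro exI[of _ e]) auto
  qed
qed

end

section \<open>From fewnomials to polynomials\<close>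

lemma num_zeros_cong:
  assumes "\<And>x. x \<in> S \<Longrightarrow> f x = 0 \<longleftrightarrow> g x = 0"
  shows "num_zeros f S = num_zeros g S"
proof -
  have "{x \<in> S. f x = 0} = {x \<in> S. g x = 0}" using assms by blast
  then show ?thesis by (simp add: num_zeros_def)
qed

lemma num_zeros_Un_disjoint:
  assumes "S \<inter> T = {}"
  shows "num_zeros f (S \<union> T) = num_zeros f S + num_zeros f T"
proof -
  have "{x \<in> S \<union> T. f x = 0} = {x \<in> S. f x = 0} \<union> {x \<in> T. f x = 0}" by blast
  moreover have "{x \<in> S. f x = 0} \<inter> {x \<in> T. f x = 0} = {}" using assms by blast
  ultimately show ?thesis unfolding num_zeros_def by (simp add: plus_emeasure)
qed

lemma num_zeros_image:
  assumes "inj_on g S"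
  shows "num_zeros f (g ` S) = num_zeros (\<lambda>y. f (g y)) S"
proof -
  have "{x \<in> g ` S. f x = 0} = g ` {y \<in> S. f (g y) = 0}" by blast
  moreover have "inj_on g {y \<in> S. f (g y) = 0}" using assms by (rule inj_on_subset) blast
  ultimately show ?thesis
    by (simp add: num_zeros_def emeasure_count_space card_image finite_image_iff)
qed

lemma fewnomial_zero_iff_ascending:
  fixes x :: "'k::field"
  assumes "x \<noteq> 0" "\<And>j. j \<in> {1..t} \<Longrightarrow> a i \<le> a j"
  shows "fewnomial t a c x = 0 \<longleftrightarrow> poly_sum {1..t} (\<lambda>j. nat (a j - a i)) c x = 0"
proof -
  have "c j * x powi a j = x powi a i * (x ^ nat (a j - a i) * c j)" if "j \<in> {1..t}" for j
  proof -
    have "x powi (a i + int n) = x powi a i * x ^ n" for n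
      using assms(1) by (simp add: power_int_add)
    from this[of "nat (a j - a i)"] have "x powi a j = x powi a i * x ^ nat (a j - a i)"
      using assms(2)[OF that] by simp
    then show ?thesis by (simp add: mult_ac)
  qed
  then have "fewnomial t a c x = x powi a i * poly_sum {1..t} (\<lambda>j. nat (a j - a i)) c x"
    unfolding fewnomial_def poly_sum_def sum_distrib_left by (intro sum.cong refl)
  then show ?thesis using assms(1) by simp
qed

text \<open>Inversion reverses the order of the exponents: the last one now provides the constant term.\<close>

lemma fewnomial_inverse_zero_iff:
  fixes y :: "'k::field"
  assumes "y \<noteq> 0" "\<And>j. j \<in> {1..t} \<Longrightarrow> a j \<le> a i"
  shows "fewnomial t a c (inverse y) = 0 \<longleftrightarrow> poly_sum {1..t} (\<lambda>j. nat (a i - a j)) c y = 0"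
proof -
  have "fewnomial t a c (inverse y) = fewnomial t (\<lambda>j. - a j) c y"
    by (simp add: fewnomial_def power_int_minus power_int_inverse)
  also have "\<dots> = 0 \<longleftrightarrow> poly_sum {1..t} (\<lambda>j. nat (- a j - - a i)) c y = 0"
    using assms by (intro fewnomial_zero_iff_ascending) auto
  finally show ?thesis by simp
qed

lemma nonzero_field_split:
  shows "UNIV - {0 :: 'k::nonarch_local_field_char_0} = (ideal_power 0 - {0}) \<union> inverse ` (ideal_power (Suc 0) - {0})"
    and "(ideal_power 0 - {0 :: 'k}) \<inter> inverse ` (ideal_power (Suc 0) - {0}) = {}"
proof -
  have inv: "absval (inverse x) = inverse (absval x)" for x :: 'k
    using absval_divide[of 1 x] by (simp add: divide_inverse)
  have ex: "x \<in> inverse ` (ideal_power (Suc 0) - {0}) \<longleftrightarrow> 1 < absval x" for x :: 'k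
  proof
    assume "x \<in> inverse ` (ideal_power (Suc 0) - {0})"
    then obtain y where "x = inverse y" "absval y < 1" "y \<noteq> 0"
      by (auto simp: ideal_power_1 maximal_ideal_def)
    then show "1 < absval x" by (simp add: inv one_less_inverse)
  next
    assume x: "1 < absval x"
    then have "absval (inverse x) < 1" by (simp add: inv inverse_less_1_iff)
    then have "inverse x \<in> ideal_power (Suc 0) - {0}"
      using x by (auto simp: ideal_power_1 maximal_ideal_def)
    then have "inverse (inverse x) \<in> inverse ` (ideal_power (Suc 0) - {0})" by (rule imageI)
    then show "x \<in> inverse ` (ideal_power (Suc 0) - {0})" by simp
  qed
  have in0: "x \<in> ideal_power 0 \<longleftrightarrow> absval x \<le> 1" for x :: 'k by (simp add: ideal_power_def)
  have "x \<in> UNIV - {0} \<longleftrightarrow> x \<in> (ideal_power 0 - {0}) \<union> inverse ` (ideal_power (Suc 0) - {0})" for x :: 'k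
    unfolding Un_iff ex using in0[of x] by auto
  then show "UNIV - {0 :: 'k} = (ideal_power 0 - {0}) \<union> inverse ` (ideal_power (Suc 0) - {0})"
    by (rule set_eqI)
  have "x \<notin> (ideal_power 0 - {0}) \<inter> inverse ` (ideal_power (Suc 0) - {0})" for x :: 'k
    unfolding Int_iff ex using in0[of x] by auto
  then show "(ideal_power 0 - {0 :: 'k}) \<inter> inverse ` (ideal_power (Suc 0) - {0}) = {}"
    by blast
qed

theorem corollary1p6p1:
  fixes M :: "'w measure"
    and c :: "nat \<Rightarrow> 'w \<Rightarrow> 'k::nonarch_local_field_char_0"
    and a :: "nat \<Rightarrow> int"
    and t :: nat
    and \<epsilon> :: real
  assumes "prob_space M"
    and "t \<ge> 2"
    and "strict_mono_on {1..t} a"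
    and "prob_space.indep_vars M (\<lambda>_. restrict_space borel valuation_ring) c {1..t}"
    and "\<And>j. j \<in> {1..t} \<Longrightarrow> uniform_in_valuation_ring M (c j)"
    and "\<epsilon> = inverse (real (card (residue_field :: 'k set set)))"
  shows "expected_zeros M t a c (valuation_ring - {0}) \<le> ennreal (inverse (1 + \<epsilon>)) \<and>
         (expected_zeros M t a c (valuation_ring - {0}) = ennreal (inverse (1 + \<epsilon>))
            \<longleftrightarrow> a 2 - a 1 = 1) \<and>
         expected_zeros M t a c (UNIV - {0}) \<le> 1 \<and>
         (expected_zeros M t a c (UNIV - {0}) = 1
            \<longleftrightarrow> a 2 - a 1 = 1 \<and> a t - a (t - 1) = 1)"
proof -
  interpret prob_space M by fact
  interpret uniform_coefficients M c "{1..t}" \<epsilon>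
    using assms(4-6) by unfold_locales auto
  have less: "a j < a k" if "1 \<le> j" "j < k" "k \<le> t" for j k
    using strict_mono_onD[OF assms(3), of j k] that by auto
  define b1 where "b1 j = nat (a j - a 1)" for j
  define b2 where "b2 j = nat (a t - a j)" for j
  have first_le: "a 1 \<le> a j" and le_last: "a j \<le> a t" if "j \<in> {1..t}" for j
    using less[of 1 j] less[of j t] that by (cases "j = 1"; cases "j = t"; force)+
  \<comment> \<open>Zeros in the valuation ring: the first term becomes the constant term.\<close>
  interpret near: random_polynomial M c "{1..t}" \<epsilon> b1 1
  proof
    show "1 \<in> {1..t}" using assms(2) by simp
    show "b1 1 = 0" by (simp add: b1_def)
    show "1 \<le> b1 j" if "j \<in> {1..t} - {1}" for j
      using less[of 1 j] that by (simp add: b1_def)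
  qed
  \<comment> \<open>Zeros outside the valuation ring, in the variable \<open>y = inverse x\<close> with \<open>\<bar>y\<bar> < 1\<close>.\<close>
  interpret far: random_polynomial M c "{1..t}" \<epsilon> b2 t
  proof
    show "t \<in> {1..t}" using assms(2) by simp
    show "b2 t = 0" by (simp add: b2_def)
    show "1 \<le> b2 j" if "j \<in> {1..t} - {t}" for j
      using less[of j t] that by (simp add: b2_def)
  qed
  have exp1: "(\<exists>j\<in>{1..t}. b1 j = 1) \<longleftrightarrow> a 2 - a 1 = 1"
  proof
    assume "\<exists>j\<in>{1..t}. b1 j = 1"
    then obtain j where j: "j \<in> {1..t}" "a j = a 1 + 1" by (auto simp: b1_def)
    then have "j \<noteq> 1" by auto
    then have "j = 2" using less[of 1 2] less[of 2 j] j by (cases "j = 2") auto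
    then show "a 2 - a 1 = 1" using j by simp
  next
    assume "a 2 - a 1 = 1"
    then show "\<exists>j\<in>{1..t}. b1 j = 1" using assms(2) by (intro bexI[of _ 2]) (auto simp: b1_def)
  qed
  have exp2: "(\<exists>j\<in>{1..t}. b2 j = 1) \<longleftrightarrow> a t - a (t - 1) = 1"
  proof
    assume "\<exists>j\<in>{1..t}. b2 j = 1"
    then obtain j where j: "j \<in> {1..t}" "a t = a j + 1" by (auto simp: b2_def)
    then have "j \<noteq> t" by auto
    then have "j < t" using j by (simp add: order_less_le)
    then have "j \<le> t - 1" by linarith
    moreover have "\<not> j < t - 1"
    proof
      assume "j < t - 1"
      then have "a j < a (t - 1)" "a (t - 1) < a t" using j(1) \<open>j < t\<close> by (auto intro!: less)
      then show False using j by simp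
    qed
    ultimately have "j = t - 1" by simp
    then show "a t - a (t - 1) = 1" using j by simp
  next
    assume "a t - a (t - 1) = 1"
    then show "\<exists>j\<in>{1..t}. b2 j = 1" using assms(2) by (intro bexI[of _ "t - 1"]) (auto simp: b2_def)
  qed
  let ?f = "\<lambda>\<omega>. fewnomial t a (\<lambda>j. c j \<omega>)"
  have num1: "num_zeros (?f \<omega>) (ideal_power 0 - {0}) = num_zeros (near.F \<omega>) (ideal_power 0 - {0})" for \<omega>
    unfolding near.F_def b1_def
    by (rule num_zeros_cong) (rule fewnomial_zero_iff_ascending, use first_le in auto)
  have num2: "num_zeros (?f \<omega>) (inverse ` (ideal_power (Suc 0) - {0})) =
      num_zeros (far.F \<omega>) (ideal_power (Suc 0) - {0})" for \<omega>
  proof -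
    have "num_zeros (?f \<omega>) (inverse ` (ideal_power (Suc 0) - {0})) =
        num_zeros (\<lambda>y. ?f \<omega> (inverse y)) (ideal_power (Suc 0) - {0})"
      by (rule num_zeros_image) (auto simp: inj_on_def)
    also have "\<dots> = num_zeros (far.F \<omega>) (ideal_power (Suc 0) - {0})"
      unfolding far.F_def b2_def
      by (rule num_zeros_cong) (rule fewnomial_inverse_zero_iff, use le_last in auto)
    finally show ?thesis .
  qed
  obtain \<Phi>1 e1 where 1: "\<Phi>1 \<in> borel_measurable M"
      "AE \<omega> in M. num_zeros (near.F \<omega>) (ideal_power 0 - {0}) = \<Phi>1 \<omega>"
      "0 \<le> e1" "integral\<^sup>N M \<Phi>1 = ennreal e1" "e1 \<le> 1 / (1 + \<epsilon>)"
      "e1 = 1 / (1 + \<epsilon>) \<longleftrightarrow> a 2 - a 1 = 1"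
    using near.expected_zeros_in_ball[of 0] exp1 by (simp only: power_0) blast
  obtain \<Phi>2 e2 where 2: "\<Phi>2 \<in> borel_measurable M"
      "AE \<omega> in M. num_zeros (far.F \<omega>) (ideal_power (Suc 0) - {0}) = \<Phi>2 \<omega>"
      "0 \<le> e2" "integral\<^sup>N M \<Phi>2 = ennreal e2" "e2 \<le> \<epsilon> / (1 + \<epsilon>)"
      "e2 = \<epsilon> / (1 + \<epsilon>) \<longleftrightarrow> a t - a (t - 1) = 1"
    using far.expected_zeros_in_ball[of "Suc 0"] exp2 by (simp only: power_Suc power_0 mult_1_right) blast
  have E1: "expected_zeros M t a c (valuation_ring - {0}) = ennreal e1"
    unfolding expected_zeros_def ideal_power_0[symmetric] num1 1(4)[symmetric]
    by (rule nn_integral_cong_AE) (rule 1(2))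
  have "expected_zeros M t a c (UNIV - {0}) = (\<integral>\<^sup>+ \<omega>. \<Phi>1 \<omega> + \<Phi>2 \<omega> \<partial>M)"
    unfolding expected_zeros_def nonzero_field_split(1) num_zeros_Un_disjoint[OF nonzero_field_split(2)] num1 num2
    by (rule nn_integral_cong_AE) (use 1(2) 2(2) in eventually_elim, simp)
  also have "\<dots> = ennreal (e1 + e2)"
    using 1 2 by (simp add: nn_integral_add ennreal_plus)
  finally have E2: "expected_zeros M t a c (UNIV - {0}) = ennreal (e1 + e2)" .
  have total: "1 / (1 + \<epsilon>) + \<epsilon> / (1 + \<epsilon>) = 1"
    using eps by (simp flip: add_divide_distrib)
  have "e1 + e2 = 1 \<longleftrightarrow> e1 = 1 / (1 + \<epsilon>) \<and> e2 = \<epsilon> / (1 + \<epsilon>)"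
    using 1(5) 2(5) total by linarith
  then have sum_eq: "ennreal (e1 + e2) = 1 \<longleftrightarrow> a 2 - a 1 = 1 \<and> a t - a (t - 1) = 1"
    unfolding ennreal_eq_1 using 1(6) 2(6) by blast
  have "ennreal e1 = ennreal (inverse (1 + \<epsilon>)) \<longleftrightarrow> e1 = 1 / (1 + \<epsilon>)"
    using 1(3) eps by (simp add: inverse_eq_divide)
  moreover have "ennreal e1 \<le> ennreal (inverse (1 + \<epsilon>))"
    using 1(5) by (intro ennreal_leI) (simp add: inverse_eq_divide)
  moreover have "ennreal (e1 + e2) \<le> 1"
    unfolding ennreal_le_1 using 1(5) 2(5) total by linarith
  ultimately show ?thesis unfolding E1 E2 using sum_eq 1(6) by blast
qed

end
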